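(* Let $(X_0,d_{X_0})$ and $(X_1,d_{X_1})$ be a pair of compatible metric spaces with respect to $(X,d_X)$, and let $(Y_0,d_{Y_0})$ and $(Y_1,d_{Y_1})$ be a pair of compatible metric spaces with respect to $(Y,d_Y)$. Let $\theta\in(0,1)$ and $q\in[1,\infty]$. Suppose $(Y,d_Y)$ is complete and $T:X\to Y$ is a closed operator such that 1. $T_0:=T|_{X_0}:X_0\to Y_0$ (in particular $T(X_0)\subseteq Y_0$) is Lipschitz with Lipschitz constant $\omega_0>0$ with respect to $d_{X_0},d_{Y_0}$; 2. $T_1:=T|_{X_1}:X_1\to Y_1$ (in particular $T(X_1)\subseteq Y_1$) is Lipschitz with Lipschitz constant $\omega_1>0$ with respect to $d_{X_1},d_{Y_1}$. Then $T$ restricts to an operator $T_{\theta,q}:=T|_{R_{\theta,q}^{\overrightarrow{X}}}:R_{\theta,q}^{\overrightarrow{X}}\to R_{\theta,q}^{\overrightarrow{Y}}$ which is Lipschitz (with respect to the metrics $\Delta_{\theta,q}$ of these two spaces) with Lipschitz constant not exceeding $2^{\theta}\,\omega_0^{1-\theta}\,\omega_1^{\theta}$.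
   Context: Closed operator: $T:X\to Y$ between metric spaces is closed if $d_X(x_n,x)\to0$ and $d_Y(T(x_n),y)\to0$ imply $y=T(x)$. The Lipschitz constant of a Lipschitz map is the infimum of all admissible constants $C>0$. Compatible pair: $X_0,X_1\subseteq X$ with $X_0\cap X_1\neq\emptyset$, and $d_0,d_1,d_X$ are metrics on $X_0,X_1,X$ (here $d_i=d_{X_i}$) such that for some constants $C_0,C_1>0$ one has $d_X(x,y)\le C_i\,d_i(x,y)$ for all $x,y\in X_i$, $i\in\{0,1\}$. This is denoted $(X_0,X_1)_X$ or $\overrightarrow{X}$. All the following is defined for any compatible pair (in particular also for $\overrightarrow{Y}=(Y_0,Y_1)_Y$). For $t>0$ and $(x,y)\in X_0^2\cup X_1^2$, the hop functional is $h_t(x,y)=\min\{d_0(x,y),t\,d_1(x,y)\}$ if $x,y\in X_0\cap X_1$; $h_t(x,y)=d_0(x,y)$ if $x,y\in X_0$ are not both in $X_1$; $h_t(x,y)=t\,d_1(x,y)$ if $x,y\in X_1$ are not both in $X_0$. An admissible linking sequence from $x$ to $y$ is a finite sequence $x_0=x,x_1,\dots,x_n=y$ in $X_0\cup X_1$ with $(x_k,x_{k+1})\in X_0^2\cup X_1^2$ for every $k$. Define $K_M(t;x,y)=\inf\sum_{k=0}^{n-1}h_t(x_k,x_{k+1})$ over all admissible linking sequences from $x$ to $y$; it is a metric on $X_0\cup X_1$, denoted $K_M(t)$. For $x,y\in X_0\cap X_1$ define $J_M(t;x,y)=\max\{d_0(x,y),t\,d_1(x,y)\}$, a metric on $X_0\cap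 X_1$, denoted $J_M(t)$. For a real sequence $(a_k)_{k\in\mathbb Z}$, $\Gamma_{\theta,q}((a_k))=\big[\sum_{k\in\mathbb Z}(2^{-k\theta}|a_k|)^q\big]^{1/q}$ if $q<\infty$ and $\Gamma_{\theta,\infty}((a_k))=\sup_{k\in\mathbb Z}2^{-k\theta}|a_k|$ (values in $[0,\infty]$). An approximating sequence of $x\in X_0\cap X_1$ in $(X_0\cap X_1,J_M(1))$ is a sequence $(x_n)_{n\ge0}$ in $X_0\cap X_1$ that is Cauchy for $J_M(1)$ and satisfies $K_M(1;x_n,x)\to0$. Given approximating sequences $(x_n)$ of $x$ and $(y_n)$ of $y$, define $S^{x,y}_k=x_k$ for $k\ge0$ and $S^{x,y}_k=y_{-k}$ for $k<0$. Then $p_{\theta,q}(x,y)=\inf\Gamma_{\theta,q}\big((J_M(2^k;S^{x,y}_k,S^{x,y}_{k+1}))_{k\in\mathbb Z}\big)$, the infimum being over all approximating sequences $(x_n)$ of $x$ and $(y_n)$ of $y$. Further, $P_{\theta,q}(x,y)=\tfrac12(p_{\theta,q}(x,y)+p_{\theta,q}(y,x))$ and $\delta_{\theta,q}(x,y)=\inf\sum_{j=0}^{n-1}P_{\theta,q}(x_j,x_{j+1})$ over all finite sequences $x_0=x,\dots,x_n=y$ in $X_0\cap X_1$; $\delta_{\theta,q}$ is a metric on $X_0\cap X_1$ and $K_M(1;x,y)\le c\,\delta_{\theta,q}(x,y)$ on $X_0\cap X_1$ for some $c>0$. Relative completion: if $(A,d_A)$, $(B,d_B)$ are metric spaces with $A\subseteq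 B$ and $d_B\le c\,d_A$ on $A$ for some $c>0$, the relative completion $A_B$ of $(A,d_A)$ in $(B,d_B)$ is the set of $x\in B$ for which there is a Cauchy sequence $(x_n)$ in $(A,d_A)$ with $d_B(x_n,x)\to0$. It carries a metric $d_{A,B}$ (taken as known) such that $d_{A,B}=d_A$ on $A$, $d_B\le c\,d_{A,B}$ on $A_B$, $A$ is dense in $(A_B,d_{A,B})$, and $(A_B,d_{A,B})$ is complete if $(B,d_B)$ is complete. The $R$-interpolated space $R_{\theta,q}^{\overrightarrow{X}}$ is the relative completion of $(X_0\cap X_1,\delta_{\theta,q})$ in $(X_0\cup X_1,K_M(1))$; its metric $d_{A,B}$ is denoted $\Delta_{\theta,q}$.
   Formalization: The metric of the relative completion is also required to make each Cauchy sequence of A that converges in B to x converge to x; the listed properties imply this if B is complete, but otherwise do not determine the metric, and the claim can fail for arbitrary choices. *)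

theory Defs
  imports "HOL-Analysis.Analysis"
begin

section \<open>Operators between metric spaces\<close>

definition closed_operator :: "'a metric \<Rightarrow> 'b metric \<Rightarrow> ('a \<Rightarrow> 'b) \<Rightarrow> bool" where
  "closed_operator X Y T \<longleftrightarrow>
     T \<in> mspace X \<rightarrow> mspace Y \<and>
     (\<forall>\<sigma> x y. range \<sigma> \<subseteq> mspace X \<longrightarrow> x \<in> mspace X \<longrightarrow> y \<in> mspace Y \<longrightarrow>
        (\<lambda>n. mdist X (\<sigma> n) x) \<longlonglongrightarrow> 0 \<longrightarrow> (\<lambda>n. mdist Y (T (\<sigma> n)) y) \<longlonglongrightarrow> 0 \<longrightarrow> y = T x)"

text \<open>Meaningful for \<^const>\<open>Lipschitz_continuous_map\<close>s only; otherwise the set is empty.\<close>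

definition lipschitz_constant :: "'a metric \<Rightarrow> 'b metric \<Rightarrow> ('a \<Rightarrow> 'b) \<Rightarrow> real" where
  "lipschitz_constant X Y f =
     Inf {C. 0 < C \<and> (\<forall>x \<in> mspace X. \<forall>y \<in> mspace X. mdist Y (f x) (f y) \<le> C * mdist X x y)}"

section \<open>Compatible pairs, the functionals K and J\<close>

definition compatible_pair :: "'a metric \<Rightarrow> 'a metric \<Rightarrow> 'a metric \<Rightarrow> bool" where
  "compatible_pair X0 X1 X \<longleftrightarrow>
     mspace X0 \<subseteq> mspace X \<and> mspace X1 \<subseteq> mspace X \<and> mspace X0 \<inter> mspace X1 \<noteq> {} \<and>
     (\<exists>C0>0. \<forall>x \<in> mspace X0. \<forall>y \<in> mspace X0. mdist X x y \<le> C0 * mdist X0 x y) \<and>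
     (\<exists>C1>0. \<forall>x \<in> mspace X1. \<forall>y \<in> mspace X1. mdist X x y \<le> C1 * mdist X1 x y)"

text \<open>To be used only for pairs in \<open>mspace X0 \<times> mspace X0 \<union> mspace X1 \<times> mspace X1\<close>.\<close>

definition hop :: "'a metric \<Rightarrow> 'a metric \<Rightarrow> real \<Rightarrow> 'a \<Rightarrow> 'a \<Rightarrow> real" where
  "hop X0 X1 t x y =
     (if x \<in> mspace X0 \<inter> mspace X1 \<and> y \<in> mspace X0 \<inter> mspace X1
        then min (mdist X0 x y) (t * mdist X1 x y)
      else if x \<in> mspace X0 \<and> y \<in> mspace X0 then mdist X0 x y
      else t * mdist X1 x y)"

text \<open>Only \<open>\<sigma> 0, \<dots>, \<sigma> n\<close> are relevant.\<close>

definition linking_sequence ::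
    "'a metric \<Rightarrow> 'a metric \<Rightarrow> 'a \<Rightarrow> 'a \<Rightarrow> nat \<Rightarrow> (nat \<Rightarrow> 'a) \<Rightarrow> bool" where
  "linking_sequence X0 X1 x y n \<sigma> \<longleftrightarrow>
     \<sigma> 0 = x \<and> \<sigma> n = y \<and> (\<forall>k\<le>n. \<sigma> k \<in> mspace X0 \<union> mspace X1) \<and>
     (\<forall>k<n. (\<sigma> k, \<sigma> (Suc k)) \<in> mspace X0 \<times> mspace X0 \<union> mspace X1 \<times> mspace X1)"

text \<open>The value \<open>0\<close> off the union only serves to make \<open>KM X0 X1 t\<close> nonnegative everywhere, as
  the locale \<^locale>\<open>Metric_space\<close> demands.\<close>

definition KM :: "'a metric \<Rightarrow> 'a metric \<Rightarrow> real \<Rightarrow> 'a \<Rightarrow> 'a \<Rightarrow> real" where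
  "KM X0 X1 t x y =
     (if x \<in> mspace X0 \<union> mspace X1 \<and> y \<in> mspace X0 \<union> mspace X1
      then Inf {(\<Sum>k<n. hop X0 X1 t (\<sigma> k) (\<sigma> (Suc k))) | n \<sigma>. linking_sequence X0 X1 x y n \<sigma>}
      else 0)"

definition JM :: "'a metric \<Rightarrow> 'a metric \<Rightarrow> real \<Rightarrow> 'a \<Rightarrow> 'a \<Rightarrow> real" where
  "JM X0 X1 t x y = max (mdist X0 x y) (t * mdist X1 x y)"

section \<open>The metric \<open>\<delta>\<close>\<close>

definition Gam :: "real \<Rightarrow> ereal \<Rightarrow> (int \<Rightarrow> real) \<Rightarrow> ennreal" where
  "Gam \<theta> q a =
     (if q = \<infinity> then (SUP k. ennreal (2 powr (- (of_int k * \<theta>)) * \<bar>a k\<bar>))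
      else if (\<lambda>k. (2 powr (- (of_int k * \<theta>)) * \<bar>a k\<bar>) powr real_of_ereal q) summable_on UNIV
      then ennreal ((\<Sum>\<^sub>\<infinity>k. (2 powr (- (of_int k * \<theta>)) * \<bar>a k\<bar>) powr real_of_ereal q)
                      powr (1 / real_of_ereal q))
      else \<infinity>)"

definition approximating_sequence ::
    "'a metric \<Rightarrow> 'a metric \<Rightarrow> 'a \<Rightarrow> (nat \<Rightarrow> 'a) \<Rightarrow> bool" where
  "approximating_sequence X0 X1 x \<sigma> \<longleftrightarrow>
     Metric_space.MCauchy (mspace X0 \<inter> mspace X1) (JM X0 X1 1) \<sigma> \<and>
     (\<lambda>n. KM X0 X1 1 (\<sigma> n) x) \<longlonglongrightarrow> 0"

definition two_sided :: "(nat \<Rightarrow> 'a) \<Rightarrow> (nat \<Rightarrow> 'a) \<Rightarrow> int \<Rightarrow> 'a" where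
  "two_sided \<sigma> \<tau> k = (if 0 \<le> k then \<sigma> (nat k) else \<tau> (nat (- k)))"

definition p_fun :: "'a metric \<Rightarrow> 'a metric \<Rightarrow> real \<Rightarrow> ereal \<Rightarrow> 'a \<Rightarrow> 'a \<Rightarrow> ennreal" where
  "p_fun X0 X1 \<theta> q x y =
     Inf {Gam \<theta> q (\<lambda>k. JM X0 X1 (2 powi k) (two_sided \<sigma> \<tau> k) (two_sided \<sigma> \<tau> (k + 1))) | \<sigma> \<tau>.
            approximating_sequence X0 X1 x \<sigma> \<and> approximating_sequence X0 X1 y \<tau>}"

definition P_fun :: "'a metric \<Rightarrow> 'a metric \<Rightarrow> real \<Rightarrow> ereal \<Rightarrow> 'a \<Rightarrow> 'a \<Rightarrow> ennreal" where
  "P_fun X0 X1 \<theta> q x y = (p_fun X0 X1 \<theta> q x y + p_fun X0 X1 \<theta> q y x) / 2"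

text \<open>The infimum is finite for \<open>x, y \<in> mspace X0 \<inter> mspace X1\<close>: for constant approximating
  sequences only one term of the two-sided sequence of jumps is nonzero, so \<open>p_fun\<close> is finite.\<close>

definition delta :: "'a metric \<Rightarrow> 'a metric \<Rightarrow> real \<Rightarrow> ereal \<Rightarrow> 'a \<Rightarrow> 'a \<Rightarrow> real" where
  "delta X0 X1 \<theta> q x y =
     enn2real (Inf {(\<Sum>j<n. P_fun X0 X1 \<theta> q (\<sigma> j) (\<sigma> (Suc j))) | n \<sigma>.
                      \<sigma> 0 = x \<and> \<sigma> n = y \<and> (\<forall>j\<le>n. \<sigma> j \<in> mspace X0 \<inter> mspace X1)})"

section \<open>Relative completion\<close>

definition relative_completion ::
    "'a set \<Rightarrow> ('a \<Rightarrow> 'a \<Rightarrow> real) \<Rightarrow> 'a set \<Rightarrow> ('a \<Rightarrow> 'a \<Rightarrow> real) \<Rightarrow> 'a set" where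
  "relative_completion A dA B dB =
     {x \<in> B. \<exists>\<sigma>. Metric_space.MCauchy A dA \<sigma> \<and> (\<lambda>n. dB (\<sigma> n) x) \<longlonglongrightarrow> 0}"

text \<open>\<open>D\<close> is the relative completion as a metric space: its metric extends \<open>dA\<close>, dominates \<open>dB\<close>,
  makes \<open>A\<close> dense, and is complete if \<open>dB\<close> is. The last clause says that the Cauchy sequences which
  put a point \<open>x\<close> into the relative completion converge to \<open>x\<close> there, so that the distance of two
  points is the limit of \<open>dA (\<sigma> n) (\<tau> n)\<close> along any such sequences. This is a consequence of the
  other clauses if \<open>dB\<close> is complete (see below); if it is not, the other clauses do not determine
  the metric.\<close>

definition is_relative_completion ::
    "'a set \<Rightarrow> ('a \<Rightarrow> 'a \<Rightarrow> real) \<Rightarrow> 'a set \<Rightarrow> ('a \<Rightarrow> 'a \<Rightarrow> real) \<Rightarrow> 'a metric \<Rightarrow> bool" where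
  "is_relative_completion A dA B dB D \<longleftrightarrow>
     mspace D = relative_completion A dA B dB \<and>
     (\<forall>x\<in>A. \<forall>y\<in>A. mdist D x y = dA x y) \<and>
     (\<forall>c>0. (\<forall>x\<in>A. \<forall>y\<in>A. dB x y \<le> c * dA x y) \<longrightarrow>
            (\<forall>x \<in> mspace D. \<forall>y \<in> mspace D. dB x y \<le> c * mdist D x y)) \<and>
     mtopology_of D closure_of A = mspace D \<and>
     (Metric_space.mcomplete B dB \<longrightarrow> mcomplete_of D) \<and>
     (\<forall>\<sigma>. \<forall>x\<in>B. Metric_space.MCauchy A dA \<sigma> \<longrightarrow> (\<lambda>n. dB (\<sigma> n) x) \<longlonglongrightarrow> 0 \<longrightarrow>
            (\<lambda>n. mdist D (\<sigma> n) x) \<longlonglongrightarrow> 0)"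

lemma relative_completion_complete_imp_convergent:
  assumes B: "Metric_space B dB" "Metric_space.mcomplete B dB" and A: "Metric_space A dA" "A \<subseteq> B"
    and c: "0 < c" "\<forall>x\<in>A. \<forall>y\<in>A. dB x y \<le> c * dA x y"
    and D: "mspace D = relative_completion A dA B dB"
    and ext: "\<forall>x\<in>A. \<forall>y\<in>A. mdist D x y = dA x y"
    and dom: "\<forall>c>0. (\<forall>x\<in>A. \<forall>y\<in>A. dB x y \<le> c * dA x y) \<longrightarrow>
            (\<forall>x \<in> mspace D. \<forall>y \<in> mspace D. dB x y \<le> c * mdist D x y)"
    and compl: "Metric_space.mcomplete B dB \<longrightarrow> mcomplete_of D"
    and \<sigma>: "Metric_space.MCauchy A dA \<sigma>" and x: "x \<in> B" and lim: "(\<lambda>n. dB (\<sigma> n) x) \<longlonglongrightarrow> 0"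
  shows "(\<lambda>n. mdist D (\<sigma> n) x) \<longlonglongrightarrow> 0"
proof -
  interpret A: Metric_space A dA by fact
  interpret B: Metric_space B dB by fact
  interpret D: Metric_space "mspace D" "mdist D" by simp
  have xD: "x \<in> mspace D"
    using \<sigma> x lim by (auto simp: D relative_completion_def)
  have AD: "A \<subseteq> mspace D"
  proof
    fix a assume a: "a \<in> A"
    then have "A.MCauchy (\<lambda>n. a)" "(\<lambda>n. dB a a) \<longlonglongrightarrow> 0"
      using A(2) by auto
    then show "a \<in> mspace D"
      using a A(2) unfolding D relative_completion_def by blast
  qed
  have \<sigma>A: "\<sigma> n \<in> A" for n
    using \<sigma> by (auto simp: A.MCauchy_def)
  have "D.MCauchy \<sigma>"
    using \<sigma> \<sigma>A AD ext by (auto simp: A.MCauchy_def D.MCauchy_def)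
  then obtain y where y: "limitin D.mtopology \<sigma> y sequentially"
    using compl B(2) by (auto simp: mcomplete_of_def D.mcomplete_def)
  then have yD: "y \<in> mspace D" and Dy: "(\<lambda>n. mdist D (\<sigma> n) y) \<longlonglongrightarrow> 0"
    by (simp_all add: D.limitin_metric_dist_null)
  have le: "dB (\<sigma> n) y \<le> c * mdist D (\<sigma> n) y" for n
    using dom[rule_format, OF c(1)] c(2) \<sigma>A AD yD by blast
  have "(\<lambda>n. c * mdist D (\<sigma> n) y) \<longlonglongrightarrow> 0"
    using tendsto_mult_right_zero[OF Dy] .
  then have "(\<lambda>n. dB (\<sigma> n) y) \<longlonglongrightarrow> 0"
    by (rule Lim_null_comparison[rotated]) (use le in \<open>auto intro!: always_eventually\<close>)
  moreover have "y \<in> B"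
    using yD D by (auto simp: relative_completion_def)
  moreover have "\<forall>\<^sub>F n in sequentially. \<sigma> n \<in> B"
    using \<sigma>A A(2) by (auto intro!: always_eventually)
  ultimately have "limitin B.mtopology \<sigma> y sequentially" "limitin B.mtopology \<sigma> x sequentially"
    using x lim by (auto simp: B.limitin_metric_dist_null)
  then have "y = x"
    using B.limitin_metric_unique trivial_limit_sequentially by blast
  then show ?thesis
    using Dy by simp
qed

section \<open>The R-interpolated space\<close>

definition R_space :: "'a metric \<Rightarrow> 'a metric \<Rightarrow> real \<Rightarrow> ereal \<Rightarrow> 'a set" where
  "R_space X0 X1 \<theta> q =
     relative_completion (mspace X0 \<inter> mspace X1) (delta X0 X1 \<theta> q)
                         (mspace X0 \<union> mspace X1) (KM X0 X1 1)"

definition is_R_metric_space ::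
    "'a metric \<Rightarrow> 'a metric \<Rightarrow> real \<Rightarrow> ereal \<Rightarrow> 'a metric \<Rightarrow> bool" where
  "is_R_metric_space X0 X1 \<theta> q D \<longleftrightarrow>
     is_relative_completion (mspace X0 \<inter> mspace X1) (delta X0 X1 \<theta> q)
                            (mspace X0 \<union> mspace X1) (KM X0 X1 1) D"

end

theory Submission
  imports Defs
begin

text \<open>Applying \<open>T\<close> to a two-sided sequence \<open>S\<close> from \<open>x\<close> to \<open>y\<close> multiplies the jumps
  \<open>J(2^k)\<close> by at most \<open>\<omega>0\<close> once the sequence is shifted by \<open>m\<close> with
  \<open>2^(m-1) < \<omega>1/\<omega>0 \<le> 2^m\<close>, since then \<open>2^k * \<omega>1 \<le> \<omega>0 * 2^(k+m)\<close>. The shift costs a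
  factor \<open>2^(m * \<theta>)\<close> in \<open>Gam\<close>, so \<open>p\<close>, and with it \<open>\<delta>\<close>, grows by at most
  \<open>\<omega>0 * (2 * \<omega>1/\<omega>0)^\<theta>\<close>. Moreover \<open>T\<close> is Lipschitz for \<open>K(1)\<close>, because it maps
  linking sequences to linking sequences. Hence \<open>T\<close> maps the Cauchy sequences that define the
  relative completion of the domain to such sequences in the range, and the estimate passes to the
  limit. That \<open>\<delta>\<close> separates points follows from \<open>d\<^sub>X \<le> c * p\<close>: the jump of \<open>S\<close> at \<open>k\<close> has
  \<open>d\<^sub>X\<close>-length at most a multiple of \<open>min 1 (2^(-k)) * 2^(k * \<theta>) * Gam\<close>, and these bounds
  form two convergent geometric series.\<close>

section \<open>Infima of extended nonnegative reals\<close>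

lemma ennreal_mult_inverse_cancel:
  assumes "0 < c"
  shows "ennreal c * (ennreal (1 / c) * a) = a" "ennreal (1 / c) * (ennreal c * a) = a"
  using assms by (simp_all add: mult.assoc [symmetric] ennreal_mult [symmetric])

text \<open>Multiplication by a positive real is an order automorphism of \<open>ennreal\<close>
  with inverse \<open>1 / c\<close>, so it commutes with infima. This carries estimates through the
  infima that define \<open>p_fun\<close> and \<open>delta\<close>.\<close>

lemma ennreal_le_mult_Inf:
  assumes c: "0 < c" and le: "\<And>s. s \<in> S \<Longrightarrow> a \<le> ennreal c * s"
  shows "a \<le> ennreal c * Inf S"
proof -
  have "ennreal (1 / c) * a \<le> Inf S"
  proof (rule Inf_greatest)
    fix s assume "s \<in> S"
    from mult_left_mono [OF le [OF this], of "ennreal (1 / c)"]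
    show "ennreal (1 / c) * a \<le> s"
      by (simp add: ennreal_mult_inverse_cancel c)
  qed
  from mult_left_mono [OF this, of "ennreal c"] show ?thesis
    by (simp add: ennreal_mult_inverse_cancel c)
qed

text \<open>A finite \<open>b\<close> can be subtracted from both sides, and for
  \<open>b = top\<close> nothing is claimed. It serves the triangle inequality for chains.\<close>

lemma ennreal_le_Inf_add:
  fixes a b :: ennreal
  assumes "\<And>s. s \<in> S \<Longrightarrow> a \<le> s + b"
  shows "a \<le> Inf S + b"
proof (cases "b = top")
  case False
  then have "a - b \<le> Inf S"
    using assms by (intro Inf_greatest) (auto simp: ennreal_minus_le_iff add.commute)
  then show ?thesis
    by (auto simp: ennreal_minus_le_iff add.commute)
qed simp

section \<open>The functional \<open>Gam\<close> as a weighted sequence norm\<close>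

lemma one_le_real_of_ereal:
  assumes "1 \<le> q" "q \<noteq> \<infinity>"
  shows "1 \<le> real_of_ereal q"
  using assms by (cases q) auto

text \<open>A norm of type \<open>l^q\<close> dominates each entry, and a divergent series makes
  \<open>Gam\<close> infinite. It later turns a value of \<open>Gam\<close> into a bound on every
  single jump.\<close>

lemma Gam_ge_term:
  assumes q: "1 \<le> q"
  shows "ennreal (2 powr (- (of_int k * \<theta>)) * \<bar>a k\<bar>) \<le> Gam \<theta> q a"
proof (cases "q = \<infinity>")
  case True
  then show ?thesis by (auto simp: Gam_def intro: SUP_upper)
next
  case False
  define r where "r = real_of_ereal q"
  have r: "1 \<le> r" using one_le_real_of_ereal q False by (simp add: r_def)
  define f where "f = (\<lambda>k. (2 powr (- (of_int k * \<theta>)) * \<bar>a k\<bar>) powr r)"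
  show ?thesis
  proof (cases "f summable_on UNIV")
    case True
    have "sum f {k} \<le> infsum f UNIV"
      by (rule finite_sum_le_infsum [OF True]) (auto simp: f_def)
    then have "f k powr (1 / r) \<le> infsum f UNIV powr (1 / r)"
      using r by (intro powr_mono2) (auto simp: f_def)
    moreover have "f k powr (1 / r) = 2 powr (- (of_int k * \<theta>)) * \<bar>a k\<bar>"
      using r by (simp add: f_def powr_powr)
    ultimately show ?thesis
      using False True by (simp add: Gam_def f_def r_def ennreal_leI)
  next
    case False
    then show ?thesis using \<open>q \<noteq> \<infinity>\<close> by (simp add: Gam_def f_def r_def)
  qed
qed

text \<open>The weight at \<open>k\<close> is \<open>2 powr (of_int m * \<theta>)\<close> times the
  weight at \<open>k + m\<close>. So the weighted \<open>b\<close> lies below a multiple of the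
  translated weighted \<open>a\<close>, and the \<open>l^q\<close> norm is homogeneous and invariant
  under translations of the integers.\<close>

lemma Gam_le_mult_shift:
  assumes q: "1 \<le> q" and c: "0 < c" and le: "\<And>k. \<bar>b k\<bar> \<le> c * \<bar>a (k + m)\<bar>"
  shows "Gam \<theta> q b \<le> ennreal (c * 2 powr (of_int m * \<theta>)) * Gam \<theta> q a"
proof -
  define C where "C = c * 2 powr (of_int m * \<theta>)"
  have C: "0 < C" using c by (simp add: C_def)
  define A B where "A = (\<lambda>k. 2 powr (- (of_int k * \<theta>)) * \<bar>a k\<bar>)"
    and "B = (\<lambda>k. 2 powr (- (of_int k * \<theta>)) * \<bar>b k\<bar>)"
  have A0: "0 \<le> A k" and B0: "0 \<le> B k" for k by (simp_all add: A_def B_def)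
  have BA: "B k \<le> C * A (k + m)" for k
  proof -
    have "B k \<le> 2 powr (- (of_int k * \<theta>)) * (c * \<bar>a (k + m)\<bar>)"
      unfolding B_def by (intro mult_left_mono le) auto
    also have "2 powr (- (of_int k * \<theta>))
        = 2 powr (of_int m * \<theta>) * 2 powr (- (of_int (k + m) * \<theta>))"
      by (simp add: powr_add [symmetric] algebra_simps)
    finally show ?thesis by (simp add: C_def A_def algebra_simps)
  qed
  show ?thesis
  proof (cases "q = \<infinity>")
    case True
    have "ennreal (B k) \<le> ennreal C * (SUP k. ennreal (A k))" for k
    proof -
      have "ennreal (B k) \<le> ennreal C * ennreal (A (k + m))"
        using BA [of k] C A0 by (simp add: ennreal_mult [symmetric] ennreal_leI)
      also have "\<dots> \<le> ennreal C * (SUP k. ennreal (A k))"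
        by (intro mult_left_mono SUP_upper) auto
      finally show ?thesis .
    qed
    then show ?thesis
      using True by (auto simp: Gam_def A_def B_def C_def intro!: SUP_least)
  next
    case False
    define r where "r = real_of_ereal q"
    have r: "1 \<le> r" using one_le_real_of_ereal q False by (simp add: r_def)
    show ?thesis
    proof (cases "(\<lambda>k. A k powr r) summable_on UNIV")
      case True
      \<comment> \<open>Translation permutes the integers, so it changes neither summability nor the
        sum.\<close>
      have bij: "bij_betw (\<lambda>k. k + m) UNIV UNIV"
        by (rule bij_betw_byWitness [where f' = "\<lambda>k. k - m"]) auto
      have As: "(\<lambda>k. A (k + m) powr r) summable_on UNIV"
        using summable_on_reindex_bij_betw [OF bij, of "\<lambda>k. A k powr r"] True by simp
      have BA': "B k powr r \<le> C powr r * A (k + m) powr r" for k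
        using powr_mono2 [OF _ B0 BA, of r k] r C A0 by (simp add: powr_mult)
      have Bs: "(\<lambda>k. B k powr r) summable_on UNIV"
        by (rule summable_on_comparison_test [OF summable_on_cmult_right [OF As, of "C powr r"]])
          (use BA' in auto)
      have "(\<Sum>\<^sub>\<infinity>k. B k powr r) \<le> (\<Sum>\<^sub>\<infinity>k. C powr r * A (k + m) powr r)"
        by (intro infsum_mono Bs summable_on_cmult_right As BA')
      also have "\<dots> = C powr r * (\<Sum>\<^sub>\<infinity>k. A k powr r)"
        using infsum_reindex_bij_betw [OF bij, of "\<lambda>k. A k powr r"]
        by (simp add: infsum_cmult_right')
      finally have "(\<Sum>\<^sub>\<infinity>k. B k powr r) powr (1 / r)
          \<le> (C powr r * (\<Sum>\<^sub>\<infinity>k. A k powr r)) powr (1 / r)"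
        using r by (intro powr_mono2) (auto intro: infsum_nonneg)
      also have "\<dots> = C * (\<Sum>\<^sub>\<infinity>k. A k powr r) powr (1 / r)"
        using r C by (subst powr_mult) (auto simp: powr_powr intro: infsum_nonneg)
      finally show ?thesis
        using False True Bs C
        by (simp add: Gam_def A_def B_def r_def C_def ennreal_mult [symmetric] ennreal_leI)
    next
      \<comment> \<open>Here the right-hand side is infinite, because \<open>C\<close> is
        positive.\<close>
      case nosum: False
      then have "Gam \<theta> q a = top"
        using False by (simp add: Gam_def A_def r_def)
      then show ?thesis using C by (simp add: C_def [symmetric] ennreal_mult_top)
    qed
  qed
qed

lemma Gam_single_finite:
  assumes "\<And>k. k \<noteq> j \<Longrightarrow> a k = 0"
  shows "Gam \<theta> q a < top"
proof (cases "q = \<infinity>")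
  case True
  have "(SUP k. ennreal (2 powr (- (of_int k * \<theta>)) * \<bar>a k\<bar>))
      \<le> ennreal (2 powr (- (of_int j * \<theta>)) * \<bar>a j\<bar>)"
  proof (rule SUP_least)
    fix k show "ennreal (2 powr (- (of_int k * \<theta>)) * \<bar>a k\<bar>)
        \<le> ennreal (2 powr (- (of_int j * \<theta>)) * \<bar>a j\<bar>)"
      using assms by (cases "k = j") auto
  qed
  then show ?thesis
    using True le_less_trans by (fastforce simp: Gam_def)
next
  case False
  have "finite {k. (2 powr (- (of_int k * \<theta>)) * \<bar>a k\<bar>) powr real_of_ereal q \<noteq> 0}"
    by (rule finite_subset [of _ "{j}"]) (use assms in auto)
  then have "(\<lambda>k. (2 powr (- (of_int k * \<theta>)) * \<bar>a k\<bar>) powr real_of_ereal q) summable_on UNIV"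
    by (intro finite_nonzero_values_imp_summable_on) simp
  then show ?thesis
    using False by (simp add: Gam_def)
qed

section \<open>Infima over finite chains\<close>

text \<open>With \<open>P = P_fun\<close> this is \<open>delta\<close> before
  \<open>enn2real\<close> is applied. Staying in \<open>ennreal\<close> lets the order arguments run
  for arbitrary \<open>P\<close>; finiteness is needed only on return to the reals.\<close>

definition chain_inf :: "'a set \<Rightarrow> ('a \<Rightarrow> 'a \<Rightarrow> ennreal) \<Rightarrow> 'a \<Rightarrow> 'a \<Rightarrow> ennreal" where
  "chain_inf A P x y = Inf {(\<Sum>j<n. P (\<sigma> j) (\<sigma> (Suc j))) | n \<sigma>.
      \<sigma> 0 = x \<and> \<sigma> n = y \<and> (\<forall>j\<le>n. \<sigma> j \<in> A)}"

lemma chain_inf_leI: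
  assumes "\<sigma> 0 = x" "\<sigma> n = y" "\<And>j. j \<le> n \<Longrightarrow> \<sigma> j \<in> A"
  shows "chain_inf A P x y \<le> (\<Sum>j<n. P (\<sigma> j) (\<sigma> (Suc j)))"
  unfolding chain_inf_def by (rule Inf_lower) (use assms in blast)

lemma chain_inf_greatest:
  assumes "\<And>n \<sigma>. \<lbrakk>\<sigma> 0 = x; \<sigma> n = y; \<And>j. j \<le> n \<Longrightarrow> \<sigma> j \<in> A\<rbrakk>
      \<Longrightarrow> a \<le> (\<Sum>j<n. P (\<sigma> j) (\<sigma> (Suc j)))"
  shows "a \<le> chain_inf A P x y"
  unfolding chain_inf_def by (rule Inf_greatest) (use assms in blast)

lemma chain_inf_le:
  assumes "x \<in> A" "y \<in> A"
  shows "chain_inf A P x y \<le> P x y"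
  using chain_inf_leI [of "\<lambda>j. if j = 0 then x else y" x 1 y A P] assms by auto

lemma chain_inf_refl: "x \<in> A \<Longrightarrow> chain_inf A P x x = 0"
  using chain_inf_leI [of "\<lambda>j. x" x 0 x A P] by auto

text \<open>Reversing a chain keeps its cost when \<open>P\<close> is symmetric.\<close>

lemma chain_inf_commute:
  assumes sym: "\<And>x y. P x y = P y x"
  shows "chain_inf A P x y = chain_inf A P y x"
proof -
  have "chain_inf A P x y \<le> chain_inf A P y x" for x y
  proof (rule chain_inf_greatest)
    fix n :: nat and \<sigma> assume \<sigma>: "\<sigma> 0 = y" "\<sigma> n = x" "\<And>j. j \<le> n \<Longrightarrow> \<sigma> j \<in> A"
    have "chain_inf A P x y \<le> (\<Sum>j<n. P (\<sigma> (n - j)) (\<sigma> (n - Suc j)))"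
      by (rule chain_inf_leI [of "\<lambda>j. \<sigma> (n - j)"]) (use \<sigma> in auto)
    also have "\<dots> = (\<Sum>j<n. P (\<sigma> (Suc j)) (\<sigma> j))"
      by (subst sum.nat_diff_reindex [symmetric]) (auto intro!: sum.cong simp: Suc_diff_Suc)
    finally show "chain_inf A P x y \<le> (\<Sum>j<n. P (\<sigma> j) (\<sigma> (Suc j)))"
      by (simp add: sym)
  qed
  then show ?thesis by (intro antisym)
qed

lemma sum_lessThan_add:
  fixes f :: "nat \<Rightarrow> 'a::comm_monoid_add"
  shows "(\<Sum>k<n + m. f k) = (\<Sum>k<n. f k) + (\<Sum>k<m. f (n + k))"
  by (induction m) (simp_all add: add.assoc)

text \<open>Chains that meet in \<open>y\<close> can be concatenated. The two infima on the right
  are then taken one after the other, without near-minimizers.\<close>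

lemma chain_inf_triangle: "chain_inf A P x z \<le> chain_inf A P x y + chain_inf A P y z"
proof -
  have *: "chain_inf A P x z \<le> (\<Sum>j<n. P (\<sigma> j) (\<sigma> (Suc j))) + (\<Sum>j<m. P (\<tau> j) (\<tau> (Suc j)))"
    if \<sigma>: "\<sigma> 0 = x" "\<sigma> n = y" "\<And>j. j \<le> n \<Longrightarrow> \<sigma> j \<in> A"
      and \<tau>: "\<tau> 0 = y" "\<tau> m = z" "\<And>j. j \<le> m \<Longrightarrow> \<tau> j \<in> A" for n m \<sigma> \<tau>
  proof -
    define \<rho> where "\<rho> = (\<lambda>j. if j < n then \<sigma> j else \<tau> (j - n))"
    \<comment> \<open>At \<open>j = n\<close> both chains sit at \<open>y\<close>, so the last jump
      of the first chain is not disturbed.\<close>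
    have \<rho>: "\<rho> j = \<sigma> j" if "j \<le> n" for j
      using that \<sigma>(2) \<tau>(1) by (cases "j = n") (auto simp: \<rho>_def)
    have "chain_inf A P x z \<le> (\<Sum>j<n + m. P (\<rho> j) (\<rho> (Suc j)))"
      by (rule chain_inf_leI) (use \<sigma> \<tau> \<rho> in \<open>auto simp: \<rho>_def\<close>)
    also have "\<dots> = (\<Sum>j<n. P (\<sigma> j) (\<sigma> (Suc j))) + (\<Sum>j<m. P (\<tau> j) (\<tau> (Suc j)))"
      unfolding sum_lessThan_add
      by (intro arg_cong2 [of _ _ _ _ "(+)"] sum.cong) (auto simp: \<rho>, auto simp: \<rho>_def Suc_diff_le)
    finally show ?thesis .
  qed
  show ?thesis
    unfolding chain_inf_def [of A P x y]
  proof (rule ennreal_le_Inf_add)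
    fix s assume "s \<in> {(\<Sum>j<n. P (\<sigma> j) (\<sigma> (Suc j))) | n \<sigma>.
        \<sigma> 0 = x \<and> \<sigma> n = y \<and> (\<forall>j\<le>n. \<sigma> j \<in> A)}"
    then obtain n \<sigma> where s: "s = (\<Sum>j<n. P (\<sigma> j) (\<sigma> (Suc j)))"
      and \<sigma>: "\<sigma> 0 = x" "\<sigma> n = y" "\<And>j. j \<le> n \<Longrightarrow> \<sigma> j \<in> A"
      by blast
    have "chain_inf A P x z \<le> chain_inf A P y z + s"
      unfolding chain_inf_def [of A P y z]
      by (rule ennreal_le_Inf_add) (use * [OF \<sigma>] in \<open>auto simp: s add.commute\<close>)
    then show "chain_inf A P x z \<le> s + chain_inf A P y z"
      by (simp add: add.commute)
  qed
qed

text \<open>By the triangle inequality for \<open>d\<close>, every chain from \<open>x\<close> to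
  \<open>y\<close> costs at least \<open>d x y\<close>. This is how positivity of
  \<open>delta\<close> is obtained.\<close>

lemma chain_inf_ge_metric:
  assumes "Metric_space A d" and le: "\<And>x y. \<lbrakk>x \<in> A; y \<in> A\<rbrakk> \<Longrightarrow> ennreal (d x y) \<le> P x y"
  shows "ennreal (d x y) \<le> chain_inf A P x y"
proof (rule chain_inf_greatest)
  interpret Metric_space A d by fact
  fix n :: nat and \<sigma> assume \<sigma>: "\<sigma> 0 = x" "\<sigma> n = y" "\<And>j. j \<le> n \<Longrightarrow> \<sigma> j \<in> A"
  have "ennreal (d (\<sigma> 0) (\<sigma> m)) \<le> (\<Sum>j<m. P (\<sigma> j) (\<sigma> (Suc j)))" if "m \<le> n" for m
    using that
  proof (induction m)
    case 0
    then show ?case using \<sigma>(3)[of 0] by simp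
  next
    case (Suc m)
    have "ennreal (d (\<sigma> 0) (\<sigma> (Suc m))) \<le> ennreal (d (\<sigma> 0) (\<sigma> m) + d (\<sigma> m) (\<sigma> (Suc m)))"
      by (intro ennreal_leI triangle \<sigma>) (use Suc.prems in auto)
    also have "\<dots> = ennreal (d (\<sigma> 0) (\<sigma> m)) + ennreal (d (\<sigma> m) (\<sigma> (Suc m)))"
      by simp
    also have "\<dots> \<le> (\<Sum>j<m. P (\<sigma> j) (\<sigma> (Suc j))) + P (\<sigma> m) (\<sigma> (Suc m))"
      using Suc by (intro add_mono le \<sigma>) auto
    finally show ?case by simp
  qed
  then show "ennreal (d x y) \<le> (\<Sum>j<n. P (\<sigma> j) (\<sigma> (Suc j)))"
    using \<sigma> by force
qed

text \<open>The image of a chain is a chain, and the estimate holds jump by jump.\<close>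

lemma chain_inf_image_le:
  assumes c: "0 < c" and f: "f \<in> A \<rightarrow> B"
    and le: "\<And>x y. \<lbrakk>x \<in> A; y \<in> A\<rbrakk> \<Longrightarrow> Q (f x) (f y) \<le> ennreal c * P x y"
  shows "chain_inf B Q (f x) (f y) \<le> ennreal c * chain_inf A P x y"
  unfolding chain_inf_def [of A]
proof (rule ennreal_le_mult_Inf [OF c])
  fix s assume "s \<in> {(\<Sum>j<n. P (\<sigma> j) (\<sigma> (Suc j))) | n \<sigma>. \<sigma> 0 = x \<and> \<sigma> n = y \<and> (\<forall>j\<le>n. \<sigma> j \<in> A)}"
  then obtain n \<sigma> where s: "s = (\<Sum>j<n. P (\<sigma> j) (\<sigma> (Suc j)))"
    and \<sigma>: "\<sigma> 0 = x" "\<sigma> n = y" "\<And>j. j \<le> n \<Longrightarrow> \<sigma> j \<in> A"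
    by blast
  have "chain_inf B Q (f x) (f y) \<le> (\<Sum>j<n. Q (f (\<sigma> j)) (f (\<sigma> (Suc j))))"
    by (rule chain_inf_leI [of "\<lambda>j. f (\<sigma> j)"]) (use \<sigma> f in auto)
  also have "\<dots> \<le> (\<Sum>j<n. ennreal c * P (\<sigma> j) (\<sigma> (Suc j)))"
    by (intro sum_mono le \<sigma>) auto
  finally show "chain_inf B Q (f x) (f y) \<le> ennreal c * s"
    by (simp add: s sum_distrib_left)
qed

lemma delta_eq_chain_inf:
  "delta X0 X1 \<theta> q x y = enn2real (chain_inf (mspace X0 \<inter> mspace X1) (P_fun X0 X1 \<theta> q) x y)"
  by (simp add: delta_def chain_inf_def)

section \<open>The functionals \<open>JM\<close> and \<open>KM\<close>, and maps acting on both
  spaces of a pair\<close>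

lemma mdist_refl [simp]: "x \<in> mspace m \<Longrightarrow> mdist m x x = 0"
  by simp

lemma Metric_space_JM:
  assumes "0 < t"
  shows "Metric_space (mspace X0 \<inter> mspace X1) (JM X0 X1 t)"
proof
  fix x y z
  show "0 \<le> JM X0 X1 t x y" by (simp add: JM_def le_max_iff_disj)
  show "JM X0 X1 t x y = JM X0 X1 t y x" by (simp add: JM_def mdist_commute)
  assume x: "x \<in> mspace X0 \<inter> mspace X1" and y: "y \<in> mspace X0 \<inter> mspace X1"
  show "JM X0 X1 t x y = 0 \<longleftrightarrow> x = y"
  proof
    assume "JM X0 X1 t x y = 0"
    then have "mdist X0 x y \<le> 0" by (simp add: JM_def max_def split: if_splits)
    then have "mdist X0 x y = 0" by (simp add: order_antisym)
    then show "x = y" using x y by simp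
  qed (use x in \<open>simp add: JM_def\<close>)
  assume z: "z \<in> mspace X0 \<inter> mspace X1"
  have "mdist X0 x z \<le> mdist X0 x y + mdist X0 y z"
    using x y z by (intro mdist_triangle) auto
  moreover have "mdist X1 x z \<le> mdist X1 x y + mdist X1 y z"
    using x y z by (intro mdist_triangle) auto
  from mult_left_mono [OF this, of t] have "t * mdist X1 x z \<le> t * mdist X1 x y + t * mdist X1 y z"
    using assms by (simp add: distrib_left)
  ultimately show "JM X0 X1 t x z \<le> JM X0 X1 t x y + JM X0 X1 t y z"
    unfolding JM_def by linarith
qed

lemma hop_nonneg: "0 \<le> t \<Longrightarrow> 0 \<le> hop X0 X1 t x y"
  by (simp add: hop_def)

text \<open>Two hops through a common point suffice. The real \<open>Inf\<close> is controlled only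
  on nonempty sets, so lower bounds for \<open>KM\<close> rest on this.\<close>

lemma linking_sequence_exists:
  assumes "mspace X0 \<inter> mspace X1 \<noteq> {}"
    and "x \<in> mspace X0 \<union> mspace X1" "y \<in> mspace X0 \<union> mspace X1"
  shows "\<exists>n \<sigma>. linking_sequence X0 X1 x y n \<sigma>"
proof -
  obtain z where z: "z \<in> mspace X0" "z \<in> mspace X1" using assms(1) by blast
  have "linking_sequence X0 X1 x y 2 (\<lambda>k. if k = 0 then x else if k = 1 then z else y)"
    using assms z by (auto simp: linking_sequence_def less_2_cases_iff)
  then show ?thesis by blast
qed

lemma KM_le_sum:
  assumes "linking_sequence X0 X1 x y n \<sigma>" and "0 \<le> t"
  shows "KM X0 X1 t x y \<le> (\<Sum>k<n. hop X0 X1 t (\<sigma> k) (\<sigma> (Suc k)))"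
proof -
  have xy: "x \<in> mspace X0 \<union> mspace X1" "y \<in> mspace X0 \<union> mspace X1"
    using assms(1) unfolding linking_sequence_def by blast+
  have bdd: "bdd_below {(\<Sum>k<n. hop X0 X1 t (\<sigma> k) (\<sigma> (Suc k))) | n \<sigma>. linking_sequence X0 X1 x y n \<sigma>}"
    by (rule bdd_belowI [of _ 0]) (auto intro!: sum_nonneg hop_nonneg assms)
  have "Inf {(\<Sum>k<n. hop X0 X1 t (\<sigma> k) (\<sigma> (Suc k))) | n \<sigma>. linking_sequence X0 X1 x y n \<sigma>}
      \<le> (\<Sum>k<n. hop X0 X1 t (\<sigma> k) (\<sigma> (Suc k)))"
    by (rule cInf_lower [OF _ bdd]) (use assms(1) in blast)
  then show ?thesis
    using xy by (simp add: KM_def)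
qed

lemma KM_greatest:
  assumes "mspace X0 \<inter> mspace X1 \<noteq> {}"
    and "x \<in> mspace X0 \<union> mspace X1" "y \<in> mspace X0 \<union> mspace X1"
    and "\<And>n \<sigma>. linking_sequence X0 X1 x y n \<sigma> \<Longrightarrow> a \<le> (\<Sum>k<n. hop X0 X1 t (\<sigma> k) (\<sigma> (Suc k)))"
  shows "a \<le> KM X0 X1 t x y"
proof -
  have "a \<le> Inf {(\<Sum>k<n. hop X0 X1 t (\<sigma> k) (\<sigma> (Suc k))) | n \<sigma>. linking_sequence X0 X1 x y n \<sigma>}"
    by (rule cInf_greatest) (use linking_sequence_exists [OF assms(1-3)] assms(4) in blast)+
  then show ?thesis
    using assms(2,3) by (simp add: KM_def)
qed

lemma KM_nonneg:
  assumes "mspace X0 \<inter> mspace X1 \<noteq> {}" "0 \<le> t"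
  shows "0 \<le> KM X0 X1 t x y"
proof (cases "x \<in> mspace X0 \<union> mspace X1 \<and> y \<in> mspace X0 \<union> mspace X1")
  case True
  then show ?thesis
    by (intro KM_greatest sum_nonneg hop_nonneg assms) auto
qed (auto simp: KM_def)

lemma KM_refl:
  assumes "mspace X0 \<inter> mspace X1 \<noteq> {}" "0 \<le> t" "x \<in> mspace X0 \<union> mspace X1"
  shows "KM X0 X1 t x x = 0"
proof (rule antisym)
  have "linking_sequence X0 X1 x x 0 (\<lambda>k. x)"
    using assms(3) by (simp add: linking_sequence_def)
  from KM_le_sum [OF this assms(2)] show "KM X0 X1 t x x \<le> 0" by simp
qed (rule KM_nonneg [OF assms(1,2)])

text \<open>The constants are any admissible ones. Equal constants serve the qualitative facts,
  where both metrics are mixed at a fixed \<open>t\<close>; distinct ones give the sharp estimate of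
  \<open>p_fun\<close>.\<close>

definition lipschitz_pair where
  "lipschitz_pair X0 X1 Y0 Y1 w0 w1 f \<longleftrightarrow>
     f \<in> mspace X0 \<rightarrow> mspace Y0 \<and> f \<in> mspace X1 \<rightarrow> mspace Y1 \<and>
     (\<forall>x \<in> mspace X0. \<forall>y \<in> mspace X0. mdist Y0 (f x) (f y) \<le> w0 * mdist X0 x y) \<and>
     (\<forall>x \<in> mspace X1. \<forall>y \<in> mspace X1. mdist Y1 (f x) (f y) \<le> w1 * mdist X1 x y)"

lemma lipschitz_pair_mono:
  assumes f: "lipschitz_pair X0 X1 Y0 Y1 w0 w1 f" and le: "w0 \<le> v0" "w1 \<le> v1"
  shows "lipschitz_pair X0 X1 Y0 Y1 v0 v1 f"
  unfolding lipschitz_pair_def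
proof (intro conjI ballI)
  fix x y assume "x \<in> mspace X0" "y \<in> mspace X0"
  then have "mdist Y0 (f x) (f y) \<le> w0 * mdist X0 x y"
    using f by (simp add: lipschitz_pair_def)
  also have "\<dots> \<le> v0 * mdist X0 x y"
    by (intro mult_right_mono le) simp
  finally show "mdist Y0 (f x) (f y) \<le> v0 * mdist X0 x y" .
next
  fix x y assume "x \<in> mspace X1" "y \<in> mspace X1"
  then have "mdist Y1 (f x) (f y) \<le> w1 * mdist X1 x y"
    using f by (simp add: lipschitz_pair_def)
  also have "\<dots> \<le> v1 * mdist X1 x y"
    by (intro mult_right_mono le) simp
  finally show "mdist Y1 (f x) (f y) \<le> v1 * mdist X1 x y" .
qed (use f in \<open>simp_all add: lipschitz_pair_def\<close>)

text \<open>The image points may lie in both \<open>Y0\<close> and \<open>Y1\<close> even if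
  \<open>x\<close> and \<open>y\<close> share only one space. The hop is then a minimum, so each
  metric available in the domain still bounds it. A common \<open>w\<close> allows either metric to
  realise the minimum in the domain.\<close>

lemma hop_image_le:
  assumes f: "lipschitz_pair X0 X1 Y0 Y1 w w f" and t: "0 \<le> t" and w: "0 \<le> w"
    and xy: "(x, y) \<in> mspace X0 \<times> mspace X0 \<union> mspace X1 \<times> mspace X1"
  shows "hop Y0 Y1 t (f x) (f y) \<le> w * hop X0 X1 t x y"
proof -
  have 0: "hop Y0 Y1 t (f x) (f y) \<le> w * mdist X0 x y" if "x \<in> mspace X0" "y \<in> mspace X0"
  proof -
    have "f x \<in> mspace Y0" "f y \<in> mspace Y0" "mdist Y0 (f x) (f y) \<le> w * mdist X0 x y"
      using f that by (auto simp: lipschitz_pair_def)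
    then show ?thesis by (auto simp: hop_def)
  qed
  have 1: "hop Y0 Y1 t (f x) (f y) \<le> w * (t * mdist X1 x y)" if "x \<in> mspace X1" "y \<in> mspace X1"
  proof -
    have "f x \<in> mspace Y1" "f y \<in> mspace Y1" "mdist Y1 (f x) (f y) \<le> w * mdist X1 x y"
      using f that by (auto simp: lipschitz_pair_def)
    moreover from mult_left_mono [OF this(3) t]
    have "t * mdist Y1 (f x) (f y) \<le> w * (t * mdist X1 x y)" by (simp add: mult.left_commute)
    ultimately show ?thesis by (auto simp: hop_def)
  qed
  show ?thesis
    using 0 1 xy unfolding hop_def [of X0] by (auto simp: min_def)
qed

lemma KM_image_le:
  assumes f: "lipschitz_pair X0 X1 Y0 Y1 w w f" and t: "0 \<le> t" and w: "0 < w"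
    and ne: "mspace X0 \<inter> mspace X1 \<noteq> {}"
    and x: "x \<in> mspace X0 \<union> mspace X1" and y: "y \<in> mspace X0 \<union> mspace X1"
  shows "KM Y0 Y1 t (f x) (f y) \<le> w * KM X0 X1 t x y"
proof -
  have "KM Y0 Y1 t (f x) (f y) / w \<le> KM X0 X1 t x y"
  proof (rule KM_greatest [OF ne x y])
    fix n \<sigma> assume \<sigma>: "linking_sequence X0 X1 x y n \<sigma>"
    have "linking_sequence Y0 Y1 (f x) (f y) n (\<lambda>k. f (\<sigma> k))"
      using \<sigma> f unfolding linking_sequence_def lipschitz_pair_def by blast
    then have "KM Y0 Y1 t (f x) (f y) \<le> (\<Sum>k<n. hop Y0 Y1 t (f (\<sigma> k)) (f (\<sigma> (Suc k))))"
      by (rule KM_le_sum [OF _ t])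
    also have "\<dots> \<le> (\<Sum>k<n. w * hop X0 X1 t (\<sigma> k) (\<sigma> (Suc k)))"
      using \<sigma> w by (intro sum_mono hop_image_le f t) (auto simp: linking_sequence_def)
    finally show "KM Y0 Y1 t (f x) (f y) / w \<le> (\<Sum>k<n. hop X0 X1 t (\<sigma> k) (\<sigma> (Suc k)))"
      using w by (simp add: sum_distrib_left [symmetric] divide_le_eq mult.commute)
  qed
  then show ?thesis using w by (simp add: divide_le_eq mult.commute)
qed

lemma compatible_pairE:
  assumes "compatible_pair X0 X1 X"
  obtains C where "0 < C"
    and "\<And>x y. \<lbrakk>x \<in> mspace X0; y \<in> mspace X0\<rbrakk> \<Longrightarrow> mdist X x y \<le> C * mdist X0 x y"
    and "\<And>x y. \<lbrakk>x \<in> mspace X1; y \<in> mspace X1\<rbrakk> \<Longrightarrow> mdist X x y \<le> C * mdist X1 x y"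
proof -
  obtain C0 C1 where C: "0 < C0" "0 < C1"
    and 0: "\<forall>x \<in> mspace X0. \<forall>y \<in> mspace X0. mdist X x y \<le> C0 * mdist X0 x y"
    and 1: "\<forall>x \<in> mspace X1. \<forall>y \<in> mspace X1. mdist X x y \<le> C1 * mdist X1 x y"
    using assms by (auto simp: compatible_pair_def)
  show ?thesis
  proof (rule that [of "max C0 C1"])
    show "mdist X x y \<le> max C0 C1 * mdist X0 x y" if "x \<in> mspace X0" "y \<in> mspace X0" for x y
      using 0 that mult_right_mono [OF max.cobounded1 [of C0 C1] mdist_nonneg [of X0 x y]]
      by force
    show "mdist X x y \<le> max C0 C1 * mdist X1 x y" if "x \<in> mspace X1" "y \<in> mspace X1" for x y
      using 1 that mult_right_mono [OF max.cobounded2 [of C1 C0] mdist_nonneg [of X1 x y]]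
      by force
  qed (use C in auto)
qed

text \<open>Each hop costs at least \<open>1 / C\<close> times the \<open>X\<close>-distance it
  covers, whichever metric is used, and the triangle inequality adds these up along the linking
  sequence.\<close>

lemma mdist_le_KM:
  assumes X: "compatible_pair X0 X1 X" and C: "0 < C"
    and C0: "\<And>x y. \<lbrakk>x \<in> mspace X0; y \<in> mspace X0\<rbrakk> \<Longrightarrow> mdist X x y \<le> C * mdist X0 x y"
    and C1: "\<And>x y. \<lbrakk>x \<in> mspace X1; y \<in> mspace X1\<rbrakk> \<Longrightarrow> mdist X x y \<le> C * mdist X1 x y"
    and x: "x \<in> mspace X0 \<union> mspace X1" and y: "y \<in> mspace X0 \<union> mspace X1"
  shows "mdist X x y \<le> C * KM X0 X1 1 x y"
proof -
  have sub: "mspace X0 \<union> mspace X1 \<subseteq> mspace X" and ne: "mspace X0 \<inter> mspace X1 \<noteq> {}"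
    using X by (auto simp: compatible_pair_def)
  have "mdist X x y / C \<le> KM X0 X1 1 x y"
  proof (rule KM_greatest [OF ne x y])
    fix n \<sigma> assume \<sigma>: "linking_sequence X0 X1 x y n \<sigma>"
    have mem: "\<sigma> k \<in> mspace X" if "k \<le> n" for k
      using \<sigma> sub that by (auto simp: linking_sequence_def)
    have "mdist X (\<sigma> 0) (\<sigma> m) \<le> (\<Sum>k<m. C * hop X0 X1 1 (\<sigma> k) (\<sigma> (Suc k)))" if "m \<le> n" for m
      using that
    proof (induction m)
      case 0
      then show ?case using mem [of 0] by simp
    next
      case (Suc m)
      have "mdist X (\<sigma> 0) (\<sigma> (Suc m)) \<le> mdist X (\<sigma> 0) (\<sigma> m) + mdist X (\<sigma> m) (\<sigma> (Suc m))"
        using Suc.prems by (intro mdist_triangle mem) auto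
      moreover have "(\<sigma> m, \<sigma> (Suc m)) \<in> mspace X0 \<times> mspace X0 \<union> mspace X1 \<times> mspace X1"
        using \<sigma> Suc.prems by (auto simp: linking_sequence_def)
      then have "mdist X (\<sigma> m) (\<sigma> (Suc m)) \<le> C * hop X0 X1 1 (\<sigma> m) (\<sigma> (Suc m))"
        using C0 C1 by (auto simp: hop_def min_def)
      ultimately show ?case using Suc by simp
    qed
    from this [of n] have "mdist X x y \<le> C * (\<Sum>k<n. hop X0 X1 1 (\<sigma> k) (\<sigma> (Suc k)))"
      using \<sigma> by (auto simp: sum_distrib_left linking_sequence_def)
    then show "mdist X x y / C \<le> (\<Sum>k<n. hop X0 X1 1 (\<sigma> k) (\<sigma> (Suc k)))"
      using C by (simp add: divide_le_eq mult.commute)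
  qed
  then show ?thesis using C by (simp add: divide_le_eq mult.commute)
qed

section \<open>Approximating sequences\<close>

lemma approximating_sequence_mem:
  "approximating_sequence X0 X1 x \<sigma> \<Longrightarrow> \<sigma> n \<in> mspace X0 \<inter> mspace X1"
  using Metric_space.MCauchy_def [OF Metric_space_JM [of 1 X0 X1]]
  by (auto simp: approximating_sequence_def)

lemma two_sided_mem:
  assumes "approximating_sequence X0 X1 x \<sigma>" "approximating_sequence X0 X1 y \<tau>"
  shows "two_sided \<sigma> \<tau> k \<in> mspace X0 \<inter> mspace X1"
  using assms approximating_sequence_mem unfolding two_sided_def by metis

text \<open>Both conditions concern tails only, so an index shift and a change of finitely many
  terms do no harm. The freedom below \<open>N\<close> is needed because shifting a two-sided
  sequence moves some of its points across index 0.\<close>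

lemma approximating_sequence_shift:
  assumes \<sigma>: "approximating_sequence X0 X1 x \<sigma>"
    and mem: "\<And>n. \<rho> n \<in> mspace X0 \<inter> mspace X1"
    and eq: "\<And>n. N \<le> n \<Longrightarrow> \<rho> n = \<sigma> (nat (int n + m))"
  shows "approximating_sequence X0 X1 x \<rho>"
proof -
  interpret J: Metric_space "mspace X0 \<inter> mspace X1" "JM X0 X1 1"
    by (rule Metric_space_JM) simp
  have "J.MCauchy \<rho>"
    unfolding J.MCauchy_def
  proof (intro conjI allI impI)
    show "range \<rho> \<subseteq> mspace X0 \<inter> mspace X1" using mem by blast
    fix e :: real assume "0 < e"
    then obtain M where M: "JM X0 X1 1 (\<sigma> n) (\<sigma> n') < e" if "M \<le> n" "M \<le> n'" for n n'
      using \<sigma> unfolding approximating_sequence_def J.MCauchy_def by meson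
    have "JM X0 X1 1 (\<rho> n) (\<rho> n') < e"
      if "max N (nat (int M - m)) \<le> n" "max N (nat (int M - m)) \<le> n'" for n n'
    proof -
      have "M \<le> nat (int n + m)" "M \<le> nat (int n' + m)" using that by linarith+
      then show ?thesis using M that by (simp add: eq)
    qed
    then show "\<exists>N. \<forall>n n'. N \<le> n \<longrightarrow> N \<le> n' \<longrightarrow> JM X0 X1 1 (\<rho> n) (\<rho> n') < e" by blast
  qed
  moreover have "(\<lambda>n. KM X0 X1 1 (\<rho> n) x) \<longlonglongrightarrow> 0"
  proof -
    have "filterlim (\<lambda>n. nat (int n + m)) sequentially sequentially"
      unfolding filterlim_at_top
    proof
      fix Z show "\<forall>\<^sub>F n in sequentially. Z \<le> nat (int n + m)"
        by (rule eventually_sequentiallyI [of "nat (int Z - m)"]) linarith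
    qed
    then have "(\<lambda>n. KM X0 X1 1 (\<sigma> (nat (int n + m))) x) \<longlonglongrightarrow> 0"
      using \<sigma> filterlim_compose unfolding approximating_sequence_def by fastforce
    then show ?thesis
      by (rule Lim_transform_eventually) (rule eventually_sequentiallyI [of N], simp add: eq)
  qed
  ultimately show ?thesis by (simp add: approximating_sequence_def)
qed

lemma approximating_sequence_const:
  assumes "x \<in> mspace X0 \<inter> mspace X1"
  shows "approximating_sequence X0 X1 x (\<lambda>n. x)"
proof -
  interpret J: Metric_space "mspace X0 \<inter> mspace X1" "JM X0 X1 1"
    by (rule Metric_space_JM) simp
  have "KM X0 X1 1 x x = 0" using assms by (intro KM_refl) auto
  then show ?thesis using assms by (simp add: approximating_sequence_def)
qed

text \<open>The map is Lipschitz for \<open>JM\<close> at \<open>t = 1\<close>, which preserves the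
  Cauchy condition, and for \<open>KM\<close> at \<open>t = 1\<close>, which preserves the
  convergence.\<close>

lemma approximating_sequence_image:
  assumes f: "lipschitz_pair X0 X1 Y0 Y1 w w f" and w: "0 < w"
    and ne: "mspace X0 \<inter> mspace X1 \<noteq> {}" and x: "x \<in> mspace X0 \<union> mspace X1"
    and \<sigma>: "approximating_sequence X0 X1 x \<sigma>"
  shows "approximating_sequence Y0 Y1 (f x) (\<lambda>n. f (\<sigma> n))"
proof -
  interpret J: Metric_space "mspace X0 \<inter> mspace X1" "JM X0 X1 1"
    by (rule Metric_space_JM) simp
  interpret J': Metric_space "mspace Y0 \<inter> mspace Y1" "JM Y0 Y1 1"
    by (rule Metric_space_JM) simp
  note mem = approximating_sequence_mem [OF \<sigma>]
  have fmem: "f (\<sigma> n) \<in> mspace Y0 \<inter> mspace Y1" for n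
    using mem [of n] f by (auto simp: lipschitz_pair_def)
  have J: "JM Y0 Y1 1 (f (\<sigma> n)) (f (\<sigma> n')) \<le> w * JM X0 X1 1 (\<sigma> n) (\<sigma> n')" for n n'
  proof -
    have "mdist Y0 (f (\<sigma> n)) (f (\<sigma> n')) \<le> w * mdist X0 (\<sigma> n) (\<sigma> n')"
      "mdist Y1 (f (\<sigma> n)) (f (\<sigma> n')) \<le> w * mdist X1 (\<sigma> n) (\<sigma> n')"
      using f mem [of n] mem [of n'] by (auto simp: lipschitz_pair_def)
    then show ?thesis
      using w by (auto simp: JM_def max_mult_distrib_left intro: max.coboundedI1 max.coboundedI2)
  qed
  have "J'.MCauchy (\<lambda>n. f (\<sigma> n))"
    unfolding J'.MCauchy_def
  proof (intro conjI allI impI)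
    show "range (\<lambda>n. f (\<sigma> n)) \<subseteq> mspace Y0 \<inter> mspace Y1" using fmem by blast
    fix e :: real assume "0 < e"
    then have "0 < e / w" using w by simp
    then obtain M where "JM X0 X1 1 (\<sigma> n) (\<sigma> n') < e / w" if "M \<le> n" "M \<le> n'" for n n'
      using \<sigma> unfolding approximating_sequence_def J.MCauchy_def by meson
    then have "JM Y0 Y1 1 (f (\<sigma> n)) (f (\<sigma> n')) < e" if "M \<le> n" "M \<le> n'" for n n'
      using that w by (intro le_less_trans [OF J]) (simp add: less_divide_eq mult.commute)
    then show "\<exists>M. \<forall>n n'. M \<le> n \<longrightarrow> M \<le> n' \<longrightarrow> JM Y0 Y1 1 (f (\<sigma> n)) (f (\<sigma> n')) < e" by blast
  qed
  moreover have "(\<lambda>n. KM Y0 Y1 1 (f (\<sigma> n)) (f x)) \<longlonglongrightarrow> 0"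
  proof (rule tendsto_sandwich)
    have "mspace Y0 \<inter> mspace Y1 \<noteq> {}" using fmem by blast
    then show "\<forall>\<^sub>F n in sequentially. 0 \<le> KM Y0 Y1 1 (f (\<sigma> n)) (f x)"
      by (simp add: KM_nonneg)
    show "\<forall>\<^sub>F n in sequentially. KM Y0 Y1 1 (f (\<sigma> n)) (f x) \<le> w * KM X0 X1 1 (\<sigma> n) x"
      by (intro always_eventually allI KM_image_le f ne x w) (use mem in auto)
    show "(\<lambda>n. w * KM X0 X1 1 (\<sigma> n) x) \<longlonglongrightarrow> 0"
      using \<sigma> by (intro tendsto_mult_right_zero) (simp add: approximating_sequence_def)
  qed simp
  ultimately show ?thesis by (simp add: approximating_sequence_def)
qed

section \<open>The functional \<open>p_fun\<close>\<close>

lemma p_fun_le_Gam: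
  assumes "approximating_sequence X0 X1 x \<sigma>" "approximating_sequence X0 X1 y \<tau>"
  shows "p_fun X0 X1 \<theta> q x y
    \<le> Gam \<theta> q (\<lambda>k. JM X0 X1 (2 powi k) (two_sided \<sigma> \<tau> k) (two_sided \<sigma> \<tau> (k + 1)))"
  unfolding p_fun_def by (rule Inf_lower) (use assms in blast)

lemma p_fun_finite:
  assumes "x \<in> mspace X0 \<inter> mspace X1" "y \<in> mspace X0 \<inter> mspace X1"
  shows "p_fun X0 X1 \<theta> q x y < top"
proof -
  have "p_fun X0 X1 \<theta> q x y \<le> Gam \<theta> q (\<lambda>k. JM X0 X1 (2 powi k)
      (two_sided (\<lambda>n. x) (\<lambda>n. y) k) (two_sided (\<lambda>n. x) (\<lambda>n. y) (k + 1)))"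
    by (intro p_fun_le_Gam approximating_sequence_const assms)
  \<comment> \<open>The only jump leads from \<open>y\<close> at index -1 to \<open>x\<close> at
    index 0.\<close>
  also have "\<dots> < top"
    by (rule Gam_single_finite [of "- 1"]) (use assms in \<open>auto simp: two_sided_def JM_def\<close>)
  finally show ?thesis .
qed

text \<open>If \<open>S\<close> joins \<open>x\<close> and \<open>y\<close>, then \<open>k\<close>
  mapped to \<open>f (S (k + m))\<close> joins \<open>f x\<close> and \<open>f y\<close>. A real
  shift \<open>log 2 (w1 / w0)\<close> would give the factor
  \<open>w0 powr (1 - \<theta>) * w1 powr \<theta>\<close>; shifts must be integers, which accounts
  for \<open>2 powr \<theta>\<close>.\<close>

lemma p_fun_image_le:
  assumes f: "lipschitz_pair X0 X1 Y0 Y1 w0 w1 f" and w: "0 < w0" "0 < w1"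
    and \<theta>: "0 < \<theta>" and q: "1 \<le> q"
    and x: "x \<in> mspace X0 \<inter> mspace X1" and y: "y \<in> mspace X0 \<inter> mspace X1"
  shows "p_fun Y0 Y1 \<theta> q (f x) (f y)
    \<le> ennreal (2 powr \<theta> * w0 powr (1 - \<theta>) * w1 powr \<theta>) * p_fun X0 X1 \<theta> q x y"
    (is "_ \<le> ennreal ?C * _")
  unfolding p_fun_def [of X0]
proof (rule ennreal_le_mult_Inf)
  show C: "0 < ?C" using w by simp
  fix s assume "s \<in> {Gam \<theta> q (\<lambda>k. JM X0 X1 (2 powi k) (two_sided \<sigma> \<tau> k) (two_sided \<sigma> \<tau> (k + 1))) | \<sigma> \<tau>.
            approximating_sequence X0 X1 x \<sigma> \<and> approximating_sequence X0 X1 y \<tau>}"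
  then obtain \<sigma> \<tau> where s: "s = Gam \<theta> q (\<lambda>k. JM X0 X1 (2 powi k) (two_sided \<sigma> \<tau> k) (two_sided \<sigma> \<tau> (k + 1)))"
    and \<sigma>: "approximating_sequence X0 X1 x \<sigma>" and \<tau>: "approximating_sequence X0 X1 y \<tau>"
    by blast
  define S where "S = two_sided \<sigma> \<tau>"
  have S: "S k \<in> mspace X0 \<inter> mspace X1" for k
    unfolding S_def using \<sigma> \<tau> by (rule two_sided_mem)
  \<comment> \<open>Rounding up yields \<open>w1 <= w0 * 2 powi m\<close>, needed for the jumps, and
    overshoots by at most 1, needed for the constant.\<close>
  define m where "m = \<lceil>log 2 (w1 / w0)\<rceil>"
  have m: "log 2 (w1 / w0) \<le> real_of_int m" "real_of_int m \<le> 1 + log 2 (w1 / w0)"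
    unfolding m_def by linarith+
  have pw: "2 powr log 2 (w1 / w0) = w1 / w0"
    using w by (simp add: powr_log_cancel)
  have "w1 / w0 \<le> 2 powr real_of_int m"
    using powr_mono [OF m(1), of 2] pw by simp
  then have m1: "w1 \<le> w0 * 2 powi m"
    using w by (simp add: powr_real_of_int' divide_le_eq mult.commute)
  have "2 powr (of_int m * \<theta>) \<le> 2 powr ((1 + log 2 (w1 / w0)) * \<theta>)"
    using m(2) \<theta> by (intro powr_mono mult_right_mono) auto
  also have "\<dots> = (2 * (w1 / w0)) powr \<theta>"
    using w by (simp add: powr_powr [symmetric] powr_add pw)
  also have "\<dots> = 2 powr \<theta> * (w1 powr \<theta> / w0 powr \<theta>)"
    using w by (simp add: powr_mult powr_divide)
  finally have "w0 * 2 powr (of_int m * \<theta>) \<le> w0 * (2 powr \<theta> * (w1 powr \<theta> / w0 powr \<theta>))"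
    using w by (intro mult_left_mono) auto
  also have "\<dots> = ?C"
    using w by (simp add: powr_diff)
  finally have mC: "w0 * 2 powr (of_int m * \<theta>) \<le> ?C" .
  \<comment> \<open>This cruder constant is used only to see that images of approximating sequences
    are approximating; it does not enter the bound.\<close>
  define w where "w = max w0 w1"
  have fw: "lipschitz_pair X0 X1 Y0 Y1 w w f" and w0: "0 < w"
    using lipschitz_pair_mono [OF f] w by (auto simp: w_def)
  have ne: "mspace X0 \<inter> mspace X1 \<noteq> {}" using x by blast
  \<comment> \<open>From \<open>n = nat (- m)\<close> on, the index \<open>int n + m\<close> is
    nonnegative and \<open>S\<close> reads off \<open>\<sigma>\<close>.\<close>
  have "approximating_sequence Y0 Y1 (f x) (\<lambda>n. f (S (int n + m)))"
    by (intro approximating_sequence_image [OF fw w0 ne]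
        approximating_sequence_shift [OF \<sigma>, where N = "nat (- m)" and m = m] S)
      (use x in \<open>auto simp: S_def two_sided_def\<close>)
  \<comment> \<open>Here the index must be strictly negative for \<open>S\<close> to read off
    \<open>\<tau>\<close>, since index 0 belongs to \<open>\<sigma>\<close>; hence the
    \<open>Suc\<close>.\<close>
  moreover have "approximating_sequence Y0 Y1 (f y) (\<lambda>n. f (S (m - int n)))"
    by (intro approximating_sequence_image [OF fw w0 ne]
        approximating_sequence_shift [OF \<tau>, where N = "Suc (nat m)" and m = "- m"] S)
      (use y in \<open>auto simp: S_def two_sided_def\<close>)
  ultimately have "p_fun Y0 Y1 \<theta> q (f x) (f y)
      \<le> Gam \<theta> q (\<lambda>k. JM Y0 Y1 (2 powi k)
          (two_sided (\<lambda>n. f (S (int n + m))) (\<lambda>n. f (S (m - int n))) k)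
          (two_sided (\<lambda>n. f (S (int n + m))) (\<lambda>n. f (S (m - int n))) (k + 1)))"
    by (rule p_fun_le_Gam)
  also have "two_sided (\<lambda>n. f (S (int n + m))) (\<lambda>n. f (S (m - int n))) = (\<lambda>k. f (S (k + m)))"
    by (auto simp: two_sided_def fun_eq_iff add.commute)
  also have "Gam \<theta> q (\<lambda>k. JM Y0 Y1 (2 powi k) (f (S (k + m))) (f (S (k + 1 + m))))
      \<le> ennreal (w0 * 2 powr (of_int m * \<theta>)) * Gam \<theta> q (\<lambda>k. JM X0 X1 (2 powi k) (S k) (S (k + 1)))"
  proof (rule Gam_le_mult_shift [OF q])
    fix k :: int
    define a b where "a = S (k + m)" and "b = S (k + 1 + m)"
    have ab: "a \<in> mspace X0" "b \<in> mspace X0" "a \<in> mspace X1" "b \<in> mspace X1"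
      using S unfolding a_def b_def by blast+
    have "mdist Y0 (f a) (f b) \<le> w0 * mdist X0 a b"
      using f ab by (simp add: lipschitz_pair_def)
    \<comment> \<open>The larger parameter \<open>2 powi (k + m)\<close> absorbs \<open>w1\<close>,
      so both metrics are stretched by \<open>w0\<close> alone.\<close>
    moreover have "2 powi k * mdist Y1 (f a) (f b) \<le> w0 * (2 powi (k + m) * mdist X1 a b)"
    proof -
      have "mdist Y1 (f a) (f b) \<le> w1 * mdist X1 a b"
        using f ab by (simp add: lipschitz_pair_def)
      also have "\<dots> \<le> (w0 * 2 powi m) * mdist X1 a b"
        by (intro mult_right_mono m1) simp
      finally have "2 powi k * mdist Y1 (f a) (f b) \<le> 2 powi k * ((w0 * 2 powi m) * mdist X1 a b)"
        by (intro mult_left_mono) auto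
      then show ?thesis by (simp add: power_int_add mult_ac)
    qed
    ultimately have "JM Y0 Y1 (2 powi k) (f a) (f b) \<le> w0 * JM X0 X1 (2 powi (k + m)) a b"
      using \<open>0 < w0\<close> by (auto simp: JM_def max_mult_distrib_left intro: max.coboundedI1 max.coboundedI2)
    moreover have "0 \<le> JM Y0 Y1 (2 powi k) (f a) (f b)" "0 \<le> JM X0 X1 (2 powi (k + m)) a b"
      by (simp_all add: JM_def le_max_iff_disj)
    ultimately show "\<bar>JM Y0 Y1 (2 powi k) (f (S (k + m))) (f (S (k + 1 + m)))\<bar>
        \<le> w0 * \<bar>JM X0 X1 (2 powi (k + m)) (S (k + m)) (S (k + m + 1))\<bar>"
      by (simp add: a_def b_def algebra_simps)
  qed fact
  also have "\<dots> \<le> ennreal ?C * s"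
    unfolding s S_def [symmetric] by (intro mult_right_mono ennreal_leI mC) auto
  finally show "p_fun Y0 Y1 \<theta> q (f x) (f y) \<le> ennreal ?C * s" .
qed

lemma sum_power_le:
  fixes r :: real
  assumes "0 \<le> r" "r < 1"
  shows "(\<Sum>k<n. r ^ k) \<le> 1 / (1 - r)"
  using assms by (simp add: sum_gp_strict divide_right_mono)

text \<open>Walk from \<open>x\<close> to \<open>\<sigma> n\<close>, along \<open>S\<close> down to
  index \<open>- n\<close>, and on to \<open>y\<close>. The walk along \<open>S\<close> is bounded
  uniformly in \<open>n\<close> by geometric series, and the two end pieces vanish in the
  limit.\<close>

lemma mdist_le_p_fun:
  assumes X: "compatible_pair X0 X1 X" and \<theta>: "0 < \<theta>" "\<theta> < 1" and q: "1 \<le> q"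
  obtains c where "0 < c"
    and "\<And>x y. \<lbrakk>x \<in> mspace X0 \<inter> mspace X1; y \<in> mspace X0 \<inter> mspace X1\<rbrakk>
      \<Longrightarrow> ennreal (mdist X x y) \<le> ennreal c * p_fun X0 X1 \<theta> q x y"
proof -
  obtain C where C: "0 < C"
    and C0: "\<And>x y. \<lbrakk>x \<in> mspace X0; y \<in> mspace X0\<rbrakk> \<Longrightarrow> mdist X x y \<le> C * mdist X0 x y"
    and C1: "\<And>x y. \<lbrakk>x \<in> mspace X1; y \<in> mspace X1\<rbrakk> \<Longrightarrow> mdist X x y \<le> C * mdist X1 x y"
    using compatible_pairE [OF X] by metis
  have sub: "mspace X0 \<subseteq> mspace X" "mspace X1 \<subseteq> mspace X"
    using X by (auto simp: compatible_pair_def)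
  \<comment> \<open>The decay ratios of the jumps: \<open>r\<close> at indices
    \<open>k >= 0\<close>, where \<open>X1\<close> with its factor \<open>2 powi k\<close> is used,
    and \<open>s\<close> at negative indices, where \<open>X0\<close> is used. Both are below 1
    because \<open>\<theta>\<close> lies strictly between 0 and 1.\<close>
  define r s where "r = 2 powr (\<theta> - 1)" and "s = 2 powr (- \<theta>)"
  have r: "0 \<le> r" "r < 1" and s: "0 \<le> s" "s < 1"
    using \<theta> powr_less_mono [of "\<theta> - 1" 0 2] powr_less_mono [of "- \<theta>" 0 2]
    by (auto simp: r_def s_def)
  define c where "c = C * (1 / (1 - r) + 1 / (1 - s))"
  have c: "0 < c" using C r s by (auto simp: c_def intro!: mult_pos_pos add_pos_pos)
  show ?thesis
  proof (rule that [OF c])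
    fix x y assume x: "x \<in> mspace X0 \<inter> mspace X1" and y: "y \<in> mspace X0 \<inter> mspace X1"
    show "ennreal (mdist X x y) \<le> ennreal c * p_fun X0 X1 \<theta> q x y"
      unfolding p_fun_def
    proof (rule ennreal_le_mult_Inf [OF c])
      fix g assume "g \<in> {Gam \<theta> q (\<lambda>k. JM X0 X1 (2 powi k) (two_sided \<sigma> \<tau> k) (two_sided \<sigma> \<tau> (k + 1))) | \<sigma> \<tau>.
            approximating_sequence X0 X1 x \<sigma> \<and> approximating_sequence X0 X1 y \<tau>}"
      then obtain \<sigma> \<tau> where g: "g = Gam \<theta> q (\<lambda>k. JM X0 X1 (2 powi k) (two_sided \<sigma> \<tau> k) (two_sided \<sigma> \<tau> (k + 1)))"
        and \<sigma>: "approximating_sequence X0 X1 x \<sigma>" and \<tau>: "approximating_sequence X0 X1 y \<tau>"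
        by blast
      define S where "S = two_sided \<sigma> \<tau>"
      have S: "S k \<in> mspace X0 \<inter> mspace X1" for k
        unfolding S_def using \<sigma> \<tau> by (rule two_sided_mem)
      have SX: "S k \<in> mspace X" for k using S sub by blast
      show "ennreal (mdist X x y) \<le> ennreal c * g"
      proof (cases "g = top")
        case True
        then show ?thesis using c by (simp add: ennreal_mult_top)
      next
        case False
        define G where "G = enn2real g"
        have G: "g = ennreal G" "0 \<le> G"
          using False by (simp_all add: G_def less_top)
        define J where "J = (\<lambda>k. JM X0 X1 (2 powi k) (S k) (S (k + 1)))"
        have gJ: "Gam \<theta> q J = ennreal G" using g by (simp add: G(1) J_def S_def)
        have J0: "0 \<le> J k" for k by (simp add: J_def JM_def le_max_iff_disj)
        have J: "J k \<le> 2 powr (of_int k * \<theta>) * G" for k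
        proof -
          have "ennreal (2 powr (- (of_int k * \<theta>)) * \<bar>J k\<bar>) \<le> ennreal G"
            using Gam_ge_term [OF q, of k \<theta> J] by (simp only: gJ)
          then have "2 powr (- (of_int k * \<theta>)) * J k \<le> G"
            using J0 G(2) by simp
          then show ?thesis
            by (simp add: powr_minus field_simps)
        qed
        have pos: "mdist X (S (int k)) (S (int k + 1)) \<le> C * G * r ^ k" for k
        proof -
          have "2 powi int k * mdist X1 (S (int k)) (S (int k + 1)) \<le> J (int k)"
            by (simp add: J_def JM_def)
          also have "\<dots> \<le> 2 powr (k * \<theta>) * G" using J [of "int k"] by simp
          finally have "mdist X1 (S (int k)) (S (int k + 1)) \<le> 2 powr (k * \<theta>) * G / 2 ^ k"
            by (simp add: le_divide_eq mult.commute)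
          also have "\<dots> = G * r ^ k"
            by (simp add: r_def powr_diff power_divide powr_power mult.commute)
          finally have "C * mdist X1 (S (int k)) (S (int k + 1)) \<le> C * (G * r ^ k)"
            using C by (intro mult_left_mono) auto
          then show ?thesis using C1 [of "S (int k)" "S (int k + 1)"] S
            by (force simp: mult.assoc)
        qed
        have neg: "mdist X (S (- int k - 1)) (S (- int k)) \<le> C * G * s ^ k" for k
        proof -
          have "mdist X0 (S (- int k - 1)) (S (- int k)) \<le> J (- int k - 1)"
            by (simp add: J_def JM_def)
          also have "\<dots> \<le> 2 powr (of_int (- int k - 1) * \<theta>) * G" by (rule J)
          \<comment> \<open>Dropping one factor \<open>s\<close> makes this series start at exponent
            0 like the other one.\<close>
          also have "\<dots> \<le> 2 powr (k * (- \<theta>)) * G"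
            using G \<theta> by (intro mult_right_mono powr_mono) (auto simp: algebra_simps)
          also have "\<dots> = G * s ^ k"
            by (simp add: s_def powr_powr powr_realpow [symmetric] mult.commute)
          finally have "C * mdist X0 (S (- int k - 1)) (S (- int k)) \<le> C * (G * s ^ k)"
            using C by (intro mult_left_mono) auto
          then show ?thesis using C0 [of "S (- int k - 1)" "S (- int k)"] S
            by (force simp: mult.assoc)
        qed
        have sum_pos: "mdist X (S 0) (S (int n)) \<le> C * G * (\<Sum>k<n. r ^ k)" for n
        proof (induction n)
          case 0
          then show ?case using SX by simp
        next
          case (Suc n)
          have "mdist X (S 0) (S (int (Suc n)))
              \<le> mdist X (S 0) (S (int n)) + mdist X (S (int n)) (S (int n + 1))"
            using mdist_triangle [OF SX SX SX, of 0 "int n + 1" "int n"] by (simp add: add.commute)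
          then show ?case using Suc pos [of n] by (simp add: distrib_left)
        qed
        have sum_neg: "mdist X (S (- int n)) (S 0) \<le> C * G * (\<Sum>k<n. s ^ k)" for n
        proof (induction n)
          case 0
          then show ?case using SX by simp
        next
          case (Suc n)
          have eq: "- int (Suc n) = - int n - 1" by simp
          have "mdist X (S (- int n - 1)) (S 0)
              \<le> mdist X (S (- int n - 1)) (S (- int n)) + mdist X (S (- int n)) (S 0)"
            by (intro mdist_triangle SX)
          then show ?case using Suc neg [of n]
            unfolding eq by (simp add: distrib_left)
        qed
        \<comment> \<open>The case \<open>n = 0\<close> is excluded because \<open>S 0\<close> is
          \<open>\<sigma> 0\<close> and not \<open>\<tau> 0\<close>.\<close>
        have bound: "mdist X x y \<le> C * KM X0 X1 1 (\<sigma> n) x + C * KM X0 X1 1 (\<tau> n) y + c * G"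
          if "1 \<le> n" for n
        proof -
          have eq: "S (int n) = \<sigma> n" "S (- int n) = \<tau> n"
            using that by (auto simp: S_def two_sided_def)
          have mem: "x \<in> mspace X" "y \<in> mspace X" using x y sub by auto
          have 1: "mdist X (S (int n)) x \<le> C * KM X0 X1 1 (\<sigma> n) x"
            unfolding eq [symmetric] by (rule mdist_le_KM [OF X C C0 C1]) (use S x in auto)
          have 2: "mdist X (S (- int n)) y \<le> C * KM X0 X1 1 (\<tau> n) y"
            unfolding eq [symmetric] by (rule mdist_le_KM [OF X C C0 C1]) (use S y in auto)
          have "C * G * (\<Sum>k<n. r ^ k) \<le> C * G * (1 / (1 - r))"
            and "C * G * (\<Sum>k<n. s ^ k) \<le> C * G * (1 / (1 - s))"
            using C G r s by (intro mult_left_mono sum_power_le; simp)+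
          then have 3: "mdist X (S 0) (S (int n)) + mdist X (S (- int n)) (S 0) \<le> c * G"
            using sum_pos [of n] sum_neg [of n] by (simp add: c_def algebra_simps)
          have "mdist X x y \<le> mdist X x (S (int n)) + mdist X (S (int n)) y"
            by (intro mdist_triangle mem SX)
          also have "mdist X (S (int n)) y \<le> mdist X (S (int n)) (S 0) + mdist X (S 0) y"
            by (intro mdist_triangle mem SX)
          also have "mdist X (S 0) y \<le> mdist X (S 0) (S (- int n)) + mdist X (S (- int n)) y"
            by (intro mdist_triangle mem SX)
          finally show ?thesis
            using 1 2 3 by (simp add: mdist_commute)
        qed
        have "(\<lambda>n. C * KM X0 X1 1 (\<sigma> n) x + C * KM X0 X1 1 (\<tau> n) y + c * G)
            \<longlonglongrightarrow> C * 0 + C * 0 + c * G"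
          using \<sigma> \<tau> unfolding approximating_sequence_def by (intro tendsto_intros) auto
        then have "mdist X x y \<le> C * 0 + C * 0 + c * G"
          by (rule LIMSEQ_le_const) (use bound in blast)
        then show ?thesis
          using c G by (simp add: ennreal_mult [symmetric] ennreal_leI)
      qed
    qed
  qed
qed

section \<open>The metric \<open>delta\<close> and its behaviour under the map\<close>

lemma P_fun_commute: "P_fun X0 X1 \<theta> q x y = P_fun X0 X1 \<theta> q y x"
  by (simp add: P_fun_def add.commute)

text \<open>The one-step chain already has finite cost. Hence \<open>enn2real\<close> in
  \<open>delta\<close> does not collapse an infinite value to 0.\<close>

lemma chain_inf_P_fun_finite:
  assumes x: "x \<in> mspace X0 \<inter> mspace X1" and y: "y \<in> mspace X0 \<inter> mspace X1"
  shows "chain_inf (mspace X0 \<inter> mspace X1) (P_fun X0 X1 \<theta> q) x y < top"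
proof -
  have "P_fun X0 X1 \<theta> q x y < top"
    using p_fun_finite [OF x y] p_fun_finite [OF y x]
    by (auto simp: P_fun_def ennreal_divide_eq_top_iff less_top [symmetric])
  then show ?thesis
    using chain_inf_le [OF x y] le_less_trans by blast
qed

text \<open>Separation is the substantial point: a positive multiple of \<open>mdist X\<close> lies
  below \<open>P_fun\<close>, hence below the cost of every chain. The other axioms come from
  \<open>chain_inf\<close>.\<close>

lemma Metric_space_delta:
  assumes X: "compatible_pair X0 X1 X" and \<theta>: "0 < \<theta>" "\<theta> < 1" and q: "1 \<le> q"
  shows "Metric_space (mspace X0 \<inter> mspace X1) (delta X0 X1 \<theta> q)"
proof
  let ?A = "mspace X0 \<inter> mspace X1" and ?P = "P_fun X0 X1 \<theta> q"
  fix x y z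
  show "0 \<le> delta X0 X1 \<theta> q x y" by (simp add: delta_eq_chain_inf)
  show "delta X0 X1 \<theta> q x y = delta X0 X1 \<theta> q y x"
    unfolding delta_eq_chain_inf by (subst chain_inf_commute [OF P_fun_commute]) (rule refl)
  assume x: "x \<in> ?A" and y: "y \<in> ?A"
  obtain c where c: "0 < c"
    and le: "\<And>x y. \<lbrakk>x \<in> ?A; y \<in> ?A\<rbrakk> \<Longrightarrow> ennreal (mdist X x y) \<le> ennreal c * p_fun X0 X1 \<theta> q x y"
    using mdist_le_p_fun [OF X \<theta> q] by metis
  have le': "ennreal (1 / c * mdist X x y) \<le> p_fun X0 X1 \<theta> q x y" if "x \<in> ?A" "y \<in> ?A" for x y
  proof -
    have "ennreal (1 / c) * ennreal (mdist X x y) \<le> ennreal (1 / c) * (ennreal c * p_fun X0 X1 \<theta> q x y)"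
      by (intro mult_left_mono le that) simp
    then show ?thesis
      unfolding ennreal_mult_inverse_cancel [OF c] using c by (simp add: ennreal_mult [symmetric])
  qed
  have sub: "?A \<subseteq> mspace X" using X by (auto simp: compatible_pair_def)
  show "delta X0 X1 \<theta> q x y = 0 \<longleftrightarrow> x = y"
  proof
    assume "delta X0 X1 \<theta> q x y = 0"
    then have 0: "chain_inf ?A ?P x y = 0"
      using chain_inf_P_fun_finite [OF x y, of \<theta> q] by (auto simp: delta_eq_chain_inf enn2real_eq_0_iff)
    have "ennreal (1 / c * mdist X x y) \<le> chain_inf ?A ?P x y"
    proof (rule chain_inf_ge_metric)
      interpret Metric_space ?A "mdist X"
        using Metric_space.subspace [OF Metric_space_mspace_mdist sub] .
      show "Metric_space ?A (\<lambda>x y. 1 / c * mdist X x y)"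
      proof
        fix x y z assume "x \<in> ?A" "y \<in> ?A" "z \<in> ?A"
        then show "1 / c * mdist X x z \<le> 1 / c * mdist X x y + 1 / c * mdist X y z"
          using c mult_left_mono [OF triangle, of x y z "1 / c"] by (simp add: distrib_left)
      qed (use c commute in auto)
      fix x y assume xy: "x \<in> ?A" "y \<in> ?A"
      define d where "d = 1 / c * mdist X x y"
      have d: "0 \<le> d" using c by (simp add: d_def)
      \<comment> \<open>As \<open>mdist X\<close> is symmetric, \<open>d\<close> bounds
        \<open>p_fun\<close> from below in both directions, and so bounds their mean.\<close>
      have "ennreal d + ennreal d \<le> p_fun X0 X1 \<theta> q x y + p_fun X0 X1 \<theta> q y x"
        using le' [OF xy] le' [OF xy(2,1)] by (intro add_mono) (simp_all add: d_def mdist_commute)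
      then have "(ennreal d + ennreal d) / 2 \<le> ?P x y"
        unfolding P_fun_def by (rule divide_right_mono_ennreal)
      also have "(ennreal d + ennreal d) / 2 = ennreal d"
        using d by (simp add: ennreal_plus [symmetric] ennreal_divide_numeral del: ennreal_plus)
      finally show "ennreal (1 / c * mdist X x y) \<le> ?P x y" by (simp add: d_def)
    qed
    then have "1 / c * mdist X x y \<le> 0" by (simp add: 0 ennreal_eq_0_iff)
    then have "mdist X x y = 0" using c by (simp add: divide_le_0_iff order_antisym)
    then show "x = y" using mdist_zero [of x X y] x y sub by blast
  next
    assume "x = y"
    then show "delta X0 X1 \<theta> q x y = 0"
      using x by (simp add: delta_eq_chain_inf chain_inf_refl)
  qed
  assume z: "z \<in> ?A"
  note fin = chain_inf_P_fun_finite [OF x y, of \<theta> q] chain_inf_P_fun_finite [OF y z, of \<theta> q]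
  have "enn2real (chain_inf ?A ?P x z) \<le> enn2real (chain_inf ?A ?P x y + chain_inf ?A ?P y z)"
    using fin by (intro enn2real_mono chain_inf_triangle) simp
  then show "delta X0 X1 \<theta> q x z \<le> delta X0 X1 \<theta> q x y + delta X0 X1 \<theta> q y z"
    using fin by (simp add: delta_eq_chain_inf enn2real_plus)
qed

text \<open>The bound for \<open>p_fun\<close> holds in both directions with the same constant, so
  it survives averaging and then summation along chains.\<close>

lemma delta_image_le:
  assumes f: "lipschitz_pair X0 X1 Y0 Y1 w0 w1 f" and w: "0 < w0" "0 < w1"
    and \<theta>: "0 < \<theta>" and q: "1 \<le> q"
    and x: "x \<in> mspace X0 \<inter> mspace X1" and y: "y \<in> mspace X0 \<inter> mspace X1"
  shows "delta Y0 Y1 \<theta> q (f x) (f y)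
    \<le> 2 powr \<theta> * w0 powr (1 - \<theta>) * w1 powr \<theta> * delta X0 X1 \<theta> q x y"
proof -
  define C where "C = 2 powr \<theta> * w0 powr (1 - \<theta>) * w1 powr \<theta>"
  have C: "0 < C" using w by (simp add: C_def)
  note p = p_fun_image_le [OF f w \<theta> q, folded C_def]
  have le: "chain_inf (mspace Y0 \<inter> mspace Y1) (P_fun Y0 Y1 \<theta> q) (f x) (f y)
      \<le> ennreal C * chain_inf (mspace X0 \<inter> mspace X1) (P_fun X0 X1 \<theta> q) x y"
  proof (rule chain_inf_image_le [OF C])
    show "f \<in> mspace X0 \<inter> mspace X1 \<rightarrow> mspace Y0 \<inter> mspace Y1"
      using f by (auto simp: lipschitz_pair_def)
    fix x y assume x: "x \<in> mspace X0 \<inter> mspace X1" and y: "y \<in> mspace X0 \<inter> mspace X1"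
    have "p_fun Y0 Y1 \<theta> q (f x) (f y) + p_fun Y0 Y1 \<theta> q (f y) (f x)
        \<le> ennreal C * (p_fun X0 X1 \<theta> q x y + p_fun X0 X1 \<theta> q y x)"
      unfolding distrib_left by (intro add_mono p x y)
    from divide_right_mono_ennreal [OF this, of 2]
    show "P_fun Y0 Y1 \<theta> q (f x) (f y) \<le> ennreal C * P_fun X0 X1 \<theta> q x y"
      by (simp add: P_fun_def ennreal_times_divide)
  qed
  \<comment> \<open>\<open>enn2real\<close> sends \<open>top\<close> to 0, so it is monotone only
    below a finite bound.\<close>
  have "ennreal C * chain_inf (mspace X0 \<inter> mspace X1) (P_fun X0 X1 \<theta> q) x y < top"
    using chain_inf_P_fun_finite [OF x y] by (simp add: ennreal_mult_less_top)
  from enn2real_mono [OF le this] show ?thesis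
    using C by (simp add: delta_eq_chain_inf enn2real_mult C_def)
qed

section \<open>Lipschitz maps between relative completions\<close>

text \<open>A sequence that puts \<open>x\<close> into the completion is mapped to one that puts
  \<open>f x\<close> into the other completion. Such sequences also converge in the metrics of the
  completions, by the last clause of \<open>is_relative_completion\<close>, so the estimate on
  \<open>A\<close> passes to the limit.\<close>

lemma relative_completion_image_le:
  assumes D: "is_relative_completion A dA B dB D" and D': "is_relative_completion A' dA' B' dB' D'"
    and A: "Metric_space A dA" and A': "Metric_space A' dA'"
    and sub: "A \<subseteq> B" and refl: "\<And>x. x \<in> A \<Longrightarrow> dB x x = 0"
    and sub': "A' \<subseteq> B'" and refl': "\<And>x. x \<in> A' \<Longrightarrow> dB' x x = 0"
    and nonneg: "\<And>x y. 0 \<le> dB' x y"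
    and fA: "f \<in> A \<rightarrow> A'" and fB: "f \<in> B \<rightarrow> B'" and c: "0 < c"
    and dA: "\<And>x y. \<lbrakk>x \<in> A; y \<in> A\<rbrakk> \<Longrightarrow> dA' (f x) (f y) \<le> c * dA x y"
    and dB: "\<And>x y. \<lbrakk>x \<in> A; y \<in> B\<rbrakk> \<Longrightarrow> dB' (f x) (f y) \<le> w * dB x y"
  shows "f \<in> mspace D \<rightarrow> mspace D'"
    and "\<And>x y. \<lbrakk>x \<in> mspace D; y \<in> mspace D\<rbrakk> \<Longrightarrow> mdist D' (f x) (f y) \<le> c * mdist D x y"
proof -
  interpret A: Metric_space A dA by fact
  interpret A': Metric_space A' dA' by fact
  have mD: "mspace D = relative_completion A dA B dB" and mD': "mspace D' = relative_completion A' dA' B' dB'"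
    and ext: "\<And>x y. \<lbrakk>x \<in> A; y \<in> A\<rbrakk> \<Longrightarrow> mdist D x y = dA x y"
    and ext': "\<And>x y. \<lbrakk>x \<in> A'; y \<in> A'\<rbrakk> \<Longrightarrow> mdist D' x y = dA' x y"
    using D D' by (simp_all add: is_relative_completion_def)
  have lim: "(\<lambda>n. mdist D (\<sigma> n) x) \<longlonglongrightarrow> 0"
    if "x \<in> B" "A.MCauchy \<sigma>" "(\<lambda>n. dB (\<sigma> n) x) \<longlonglongrightarrow> 0" for \<sigma> x
    using D that by (simp add: is_relative_completion_def)
  have lim': "(\<lambda>n. mdist D' (\<sigma> n) x) \<longlonglongrightarrow> 0"
    if "x \<in> B'" "A'.MCauchy \<sigma>" "(\<lambda>n. dB' (\<sigma> n) x) \<longlonglongrightarrow> 0" for \<sigma> x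
    using D' that by (simp add: is_relative_completion_def)
  have AD: "A \<subseteq> mspace D"
  proof
    fix a assume a: "a \<in> A"
    then have "A.MCauchy (\<lambda>n. a)" "(\<lambda>n. dB a a) \<longlonglongrightarrow> 0" by (simp_all add: refl)
    then show "a \<in> mspace D" using a sub unfolding mD relative_completion_def by blast
  qed
  have AD': "A' \<subseteq> mspace D'"
  proof
    fix a assume a: "a \<in> A'"
    then have "A'.MCauchy (\<lambda>n. a)" "(\<lambda>n. dB' a a) \<longlonglongrightarrow> 0" by (simp_all add: refl')
    then show "a \<in> mspace D'" using a sub' unfolding mD' relative_completion_def by blast
  qed
  have image: "A'.MCauchy (\<lambda>n. f (\<sigma> n)) \<and> (\<lambda>n. dB' (f (\<sigma> n)) (f x)) \<longlonglongrightarrow> 0"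
    if x: "x \<in> B" and \<sigma>: "A.MCauchy \<sigma>" and l: "(\<lambda>n. dB (\<sigma> n) x) \<longlonglongrightarrow> 0" for \<sigma> x
  proof
    have \<sigma>A: "\<sigma> n \<in> A" for n using \<sigma> by (auto simp: A.MCauchy_def)
    show "A'.MCauchy (\<lambda>n. f (\<sigma> n))"
      unfolding A'.MCauchy_def
    proof (intro conjI allI impI)
      show "range (\<lambda>n. f (\<sigma> n)) \<subseteq> A'" using \<sigma>A fA by auto
      fix e :: real assume "0 < e"
      then have "0 < e / c" using c by simp
      then obtain M where "dA (\<sigma> n) (\<sigma> n') < e / c" if "M \<le> n" "M \<le> n'" for n n'
        using \<sigma> unfolding A.MCauchy_def by meson
      then have "dA' (f (\<sigma> n)) (f (\<sigma> n')) < e" if "M \<le> n" "M \<le> n'" for n n'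
        using that c by (intro le_less_trans [OF dA [OF \<sigma>A \<sigma>A]]) (simp add: less_divide_eq mult.commute)
      then show "\<exists>M. \<forall>n n'. M \<le> n \<longrightarrow> M \<le> n' \<longrightarrow> dA' (f (\<sigma> n)) (f (\<sigma> n')) < e" by blast
    qed
    show "(\<lambda>n. dB' (f (\<sigma> n)) (f x)) \<longlonglongrightarrow> 0"
    proof (rule tendsto_sandwich)
      show "\<forall>\<^sub>F n in sequentially. 0 \<le> dB' (f (\<sigma> n)) (f x)" by (simp add: nonneg)
      show "\<forall>\<^sub>F n in sequentially. dB' (f (\<sigma> n)) (f x) \<le> w * dB (\<sigma> n) x"
        by (simp add: dB \<sigma>A x)
      show "(\<lambda>n. w * dB (\<sigma> n) x) \<longlonglongrightarrow> 0" by (rule tendsto_mult_right_zero [OF l])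
    qed simp
  qed
  show fD: "f \<in> mspace D \<rightarrow> mspace D'"
  proof
    fix x assume "x \<in> mspace D"
    then obtain \<sigma> where x: "x \<in> B" and "A.MCauchy \<sigma>" "(\<lambda>n. dB (\<sigma> n) x) \<longlonglongrightarrow> 0"
      by (auto simp: mD relative_completion_def)
    from image [OF this] show "f x \<in> mspace D'"
      using x fB unfolding mD' relative_completion_def by blast
  qed
  fix x y assume xD: "x \<in> mspace D" and yD: "y \<in> mspace D"
  from xD obtain \<sigma> where x: "x \<in> B" and \<sigma>: "A.MCauchy \<sigma>" "(\<lambda>n. dB (\<sigma> n) x) \<longlonglongrightarrow> 0"
    by (auto simp: mD relative_completion_def)
  from yD obtain \<tau> where y: "y \<in> B" and \<tau>: "A.MCauchy \<tau>" "(\<lambda>n. dB (\<tau> n) y) \<longlonglongrightarrow> 0"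
    by (auto simp: mD relative_completion_def)
  have A: "\<sigma> n \<in> A" "\<tau> n \<in> A" for n
    using \<sigma>(1) \<tau>(1) by (auto simp: A.MCauchy_def)
  \<comment> \<open>The total error of replacing \<open>x\<close> and \<open>y\<close> by
    \<open>\<sigma> n\<close> and \<open>\<tau> n\<close> on both sides of the estimate; it tends to
    0.\<close>
  define e where "e = (\<lambda>n. mdist D' (f (\<sigma> n)) (f x) + mdist D' (f (\<tau> n)) (f y)
      + c * (mdist D (\<sigma> n) x + mdist D (\<tau> n) y))"
  have "(\<lambda>n. e n + c * mdist D x y) \<longlonglongrightarrow> 0 + 0 + c * (0 + 0) + c * mdist D x y"
    unfolding e_def using image [OF x \<sigma>] image [OF y \<tau>] x y fB
    by (intro tendsto_intros lim lim' \<sigma> \<tau>) auto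
  moreover have "mdist D' (f x) (f y) \<le> e n + c * mdist D x y" for n
  proof -
    have fA': "f (\<sigma> n) \<in> A'" "f (\<tau> n) \<in> A'" using A fA by auto
    then have mem: "f (\<sigma> n) \<in> mspace D'" "f (\<tau> n) \<in> mspace D'" "f x \<in> mspace D'" "f y \<in> mspace D'"
      using AD' fD xD yD by auto
    have mem': "\<sigma> n \<in> mspace D" "\<tau> n \<in> mspace D" using A AD by auto
    have "mdist D (\<sigma> n) (\<tau> n) \<le> mdist D (\<sigma> n) x + mdist D x (\<tau> n)"
      by (intro mdist_triangle xD mem')
    also have "mdist D x (\<tau> n) \<le> mdist D x y + mdist D y (\<tau> n)"
      by (intro mdist_triangle xD yD mem')
    finally have "c * mdist D (\<sigma> n) (\<tau> n) \<le> c * (mdist D (\<sigma> n) x + (mdist D x y + mdist D y (\<tau> n)))"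
      using c by (intro mult_left_mono) auto
    moreover have "mdist D' (f (\<sigma> n)) (f (\<tau> n)) \<le> c * mdist D (\<sigma> n) (\<tau> n)"
      using dA [OF A] by (simp add: ext ext' A fA')
    moreover have "mdist D' (f x) (f y) \<le> mdist D' (f x) (f (\<sigma> n)) + mdist D' (f (\<sigma> n)) (f y)"
      by (intro mdist_triangle mem)
    moreover have "mdist D' (f (\<sigma> n)) (f y) \<le> mdist D' (f (\<sigma> n)) (f (\<tau> n)) + mdist D' (f (\<tau> n)) (f y)"
      by (intro mdist_triangle mem)
    ultimately show ?thesis
      unfolding e_def by (simp add: mdist_commute [of D' "f x" "f (\<sigma> n)"] mdist_commute [of D y "\<tau> n"] distrib_left)
  qed
  ultimately show "mdist D' (f x) (f y) \<le> c * mdist D x y"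
    using LIMSEQ_le_const by fastforce
qed

section \<open>Lipschitz constants and the interpolation theorem\<close>

text \<open>The infimum is itself admissible: at positive distance divide by it and compare with all
  admissible constants; at distance 0 any one of them shows that the images have distance 0.\<close>

lemma mdist_le_lipschitz_constant:
  assumes f: "Lipschitz_continuous_map X Y f" and x: "x \<in> mspace X" and y: "y \<in> mspace X"
  shows "mdist Y (f x) (f y) \<le> lipschitz_constant X Y f * mdist X x y"
proof -
  let ?L = "{C. 0 < C \<and> (\<forall>x \<in> mspace X. \<forall>y \<in> mspace X. mdist Y (f x) (f y) \<le> C * mdist X x y)}"
  have ne: "?L \<noteq> {}" using f by (auto simp: Lipschitz_continuous_map_pos)
  show ?thesis
  proof (cases "mdist X x y = 0")
    case True
    obtain C where "C \<in> ?L" using ne by blast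
    then have "mdist Y (f x) (f y) \<le> C * mdist X x y" using x y by blast
    then show ?thesis using True by simp
  next
    case False
    then have d: "0 < mdist X x y" by (simp add: order_less_le)
    have "mdist Y (f x) (f y) / mdist X x y \<le> Inf ?L"
      by (rule cInf_greatest [OF ne]) (use x y d in \<open>auto simp: divide_le_eq\<close>)
    then show ?thesis using d by (simp add: lipschitz_constant_def divide_le_eq)
  qed
qed

lemma lipschitz_constant_le:
  assumes "0 < C" "\<And>x y. \<lbrakk>x \<in> mspace X; y \<in> mspace X\<rbrakk> \<Longrightarrow> mdist Y (f x) (f y) \<le> C * mdist X x y"
  shows "lipschitz_constant X Y f \<le> C"
  unfolding lipschitz_constant_def
  by (rule cInf_lower) (use assms in \<open>auto intro: bdd_belowI [of _ 0]\<close>)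

theorem theorem4p2:
  fixes X0 X1 X RX :: "'a metric" and Y0 Y1 Y RY :: "'b metric"
    and T :: "'a \<Rightarrow> 'b" and \<theta> \<omega>0 \<omega>1 :: real and q :: ereal
  assumes "compatible_pair X0 X1 X" and "compatible_pair Y0 Y1 Y"
    and "0 < \<theta>" "\<theta> < 1" and "1 \<le> q"
    and "is_R_metric_space X0 X1 \<theta> q RX" and "is_R_metric_space Y0 Y1 \<theta> q RY"
    and "mcomplete_of Y" and "closed_operator X Y T"
    and "Lipschitz_continuous_map X0 Y0 T" and "lipschitz_constant X0 Y0 T = \<omega>0" and "0 < \<omega>0"
    and "Lipschitz_continuous_map X1 Y1 T" and "lipschitz_constant X1 Y1 T = \<omega>1" and "0 < \<omega>1"
  shows "T \<in> R_space X0 X1 \<theta> q \<rightarrow> R_space Y0 Y1 \<theta> q \<and>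
         Lipschitz_continuous_map RX RY T \<and>
         lipschitz_constant RX RY T \<le> 2 powr \<theta> * \<omega>0 powr (1 - \<theta>) * \<omega>1 powr \<theta>"
proof -
  have T: "lipschitz_pair X0 X1 Y0 Y1 \<omega>0 \<omega>1 T"
    unfolding lipschitz_pair_def
  proof (intro conjI ballI)
    show "T \<in> mspace X0 \<rightarrow> mspace Y0" "T \<in> mspace X1 \<rightarrow> mspace Y1"
      using assms(10,13) by (simp_all add: Lipschitz_continuous_map_image)
  qed (use mdist_le_lipschitz_constant [OF assms(10)] mdist_le_lipschitz_constant [OF assms(13)]
      in \<open>simp_all add: assms(11,14)\<close>)
  \<comment> \<open>A common constant for the estimate of \<open>KM\<close>, which governs
    convergence but not the final Lipschitz bound.\<close>
  define w where "w = max \<omega>0 \<omega>1"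
  have Tw: "lipschitz_pair X0 X1 Y0 Y1 w w T" and w: "0 < w"
    using lipschitz_pair_mono [OF T, of w w] assms(12) by (simp_all add: w_def)
  define C where "C = 2 powr \<theta> * \<omega>0 powr (1 - \<theta>) * \<omega>1 powr \<theta>"
  have C: "0 < C" using assms(12,15) by (simp add: C_def)
  have X: "mspace X0 \<inter> mspace X1 \<noteq> {}" and Y: "mspace Y0 \<inter> mspace Y1 \<noteq> {}"
    using assms(1,2) by (simp_all add: compatible_pair_def)
  have mspace: "mspace RX = R_space X0 X1 \<theta> q" "mspace RY = R_space Y0 Y1 \<theta> q"
    using assms(6,7) by (simp_all add: is_R_metric_space_def is_relative_completion_def R_space_def)
  have TA: "T \<in> mspace X0 \<inter> mspace X1 \<rightarrow> mspace Y0 \<inter> mspace Y1"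
    and TB: "T \<in> mspace X0 \<union> mspace X1 \<rightarrow> mspace Y0 \<union> mspace Y1"
    using T by (auto simp: lipschitz_pair_def)
  have refl: "KM X0 X1 1 x x = 0" if "x \<in> mspace X0 \<inter> mspace X1" for x
    using that by (intro KM_refl X) auto
  have refl': "KM Y0 Y1 1 x x = 0" if "x \<in> mspace Y0 \<inter> mspace Y1" for x
    using that by (intro KM_refl Y) auto
  have nonneg: "0 \<le> KM Y0 Y1 1 x y" for x y
    by (intro KM_nonneg Y) simp
  have delta: "delta Y0 Y1 \<theta> q (T x) (T y) \<le> C * delta X0 X1 \<theta> q x y"
    if "x \<in> mspace X0 \<inter> mspace X1" "y \<in> mspace X0 \<inter> mspace X1" for x y
    unfolding C_def by (rule delta_image_le [OF T assms(12,15,3,5) that])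
  have KM: "KM Y0 Y1 1 (T x) (T y) \<le> w * KM X0 X1 1 x y"
    if "x \<in> mspace X0 \<inter> mspace X1" "y \<in> mspace X0 \<union> mspace X1" for x y
    by (rule KM_image_le [OF Tw _ w X]) (use that in auto)
  have sub: "mspace X0 \<inter> mspace X1 \<subseteq> mspace X0 \<union> mspace X1"
    "mspace Y0 \<inter> mspace Y1 \<subseteq> mspace Y0 \<union> mspace Y1" by blast+
  \<comment> \<open>The inner metrics are the \<open>delta\<close>, estimated with the sharp
    \<open>C\<close>; the outer ones are the \<open>KM\<close>, estimated with
    \<open>w\<close>.\<close>
  note R = relative_completion_image_le [OF assms(6,7) [unfolded is_R_metric_space_def]
      Metric_space_delta [OF assms(1,3-5)] Metric_space_delta [OF assms(2,3-5)]
      sub(1) refl sub(2) refl' nonneg TA TB C delta KM]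
  have "Lipschitz_continuous_map RX RY T"
    using R unfolding Lipschitz_continuous_map_def by blast
  moreover have "lipschitz_constant RX RY T \<le> C"
    using lipschitz_constant_le [OF C R(2)] .
  ultimately show ?thesis
    using R(1) by (simp add: mspace C_def)
qed

end
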